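(* Let $n,k$ be positive integers and let $\mu$ be a partition. Then in the ring of symmetric functions $\Lambda_{\mathbb{Q}}$, $$(p_{n}\circ h_{k})\,s_{\mu}=\sum_{\substack{\lambda\vdash |\mu|+nk\\ \mu\subset\lambda}}\det\big(\mathcal{M}(\lambda/\mu)\big)\,s_{\lambda},$$ and for every partition $\lambda\vdash|\mu|+nk$ with $\mu\subset\lambda$, $$\det(\mathcal{M}(\lambda/\mu))=\begin{cases}\operatorname{sgn}(\lambda/\mu) & \text{if } \lambda/\mu \text{ is a horizontal } n\text{-border strip of weight } k,\\ 0&\text{otherwise.}\end{cases}$$
   Context: $\Lambda_{\mathbb{Q}}$ is the ring of symmetric functions over $\mathbb{Q}$ in infinitely many variables; $p_n$, $h_k$, $s_\lambda$ are the power sum, complete homogeneous and Schur functions; the plethysm $p_n\circ h_k$ is $h_k(x_1^n,x_2^n,\ldots)$. For partitions, $\mu\subset\lambda$ means $\mu_i\le\lambda_i$ for all $i$, and $\ell(\lambda)$ is the number of nonzero parts. Young diagrams are drawn with rows numbered from top to bottom and columns from left to right. Matrix: for $\mu\subset\lambda$, $\mathcal{M}(\lambda/\mu)=(m_{ij})$ is the $\ell(\lambda)\times\ell(\lambda)$ matrix with $m_{ij}=1$ if $\lambda_i-i\ge\mu_j-j$ and $n\mid(\lambda_i-i-\mu_j+j)$, and $m_{ij}=0$ otherwise ($\mu$ padded with zeros at the end if $\ell(\mu)<\ell(\lambda)$). Border strips: a skew diagram is an $r$-border strip if it consists of $r$ boxes, is connected and contains no $2\times 2$ square. Its height $ht$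 is its number of rows minus 1. Its starting box is its northeasternmost box. $(\lambda/\mu)\!\uparrow$ is the set consisting of the top box of each (nonempty) column of $\lambda/\mu$. Horizontal $n$-border strip: $\lambda/\mu$ is a horizontal $n$-border strip of weight $k$ if there is a chain of partitions $\mu=\alpha^{(0)}\subset\alpha^{(1)}\subset\cdots\subset\alpha^{(k)}=\lambda$ such that each $\alpha^{(i)}/\alpha^{(i-1)}$ is an $n$-border strip, the starting box of each $\alpha^{(i)}/\alpha^{(i-1)}$ lies in $(\lambda/\mu)\!\uparrow$, and for $i<j$ the starting box of $\alpha^{(i)}/\alpha^{(i-1)}$ lies southwest (weakly below and strictly to the left) of the starting box of $\alpha^{(j)}/\alpha^{(j-1)}$. Such a chain is unique if it exists, and then $\operatorname{sgn}(\lambda/\mu):=\prod_{i=1}^{k}(-1)^{ht(\alpha^{(i)}/\alpha^{(i-1)})}$. *)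

theory Defs
  imports "Jordan_Normal_Form.Determinant" "HOL-Combinatorics.Permutations" "HOL-Library.Multiset"
begin

text \<open>
  The ring of symmetric functions over the rationals in variables \<open>x\<^sub>0, x\<^sub>1, \<dots>\<close> is the ring of
  formal power series of bounded degree that are invariant under all finite permutations of the
  variables. A monomial is a multiset of variable indices: \<open>m\<close> stands for the product of
  \<open>x\<^sub>i ^ count m i\<close>, and \<open>scoeff f m\<close> is the coefficient of that monomial in \<open>f\<close>.
\<close>

definition symmetric_series :: "(nat multiset \<Rightarrow> rat) \<Rightarrow> bool" where
  "symmetric_series f \<longleftrightarrow>
     (\<forall>\<pi> S m. finite S \<longrightarrow> \<pi> permutes S \<longrightarrow> f (image_mset \<pi> m) = f m)"

definition bounded_degree :: "(nat multiset \<Rightarrow> rat) \<Rightarrow> bool" where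
  "bounded_degree f \<longleftrightarrow> (\<exists>d. \<forall>m. size m > d \<longrightarrow> f m = 0)"

typedef symfun = "{f. symmetric_series f \<and> bounded_degree f}"
  morphisms scoeff Abs_symfun
  by (rule exI[of _ "\<lambda>_. 0"]) (simp add: symmetric_series_def bounded_degree_def)

setup_lifting type_definition_symfun

lemma symfun_eqI: "(\<And>m. scoeff f m = scoeff g m) \<Longrightarrow> f = g"
  by (metis scoeff_inject ext)

lemma bij_betw_permuted_submultisets:
  assumes "\<pi> permutes S"
  shows "bij_betw (image_mset \<pi>) {a. a \<subseteq># m} {a. a \<subseteq># image_mset \<pi> m}"
proof (rule bij_betw_byWitness[where f' = "image_mset (inv_into UNIV \<pi>)"])
  have i: "inv_into UNIV \<pi> (\<pi> x) = x" "\<pi> (inv_into UNIV \<pi> x) = x" for x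
    using assms permutes_inverses by metis+
  show "\<forall>a\<in>{a. a \<subseteq># m}. image_mset (inv_into UNIV \<pi>) (image_mset \<pi> a) = a"
    by (simp add: multiset.map_comp o_def i)
  show "\<forall>a\<in>{a. a \<subseteq># image_mset \<pi> m}. image_mset \<pi> (image_mset (inv_into UNIV \<pi>) a) = a"
    by (simp add: multiset.map_comp o_def i)
  show "image_mset \<pi> ` {a. a \<subseteq># m} \<subseteq> {a. a \<subseteq># image_mset \<pi> m}"
    by (auto intro: image_mset_subseteq_mono)
  show "image_mset (inv_into UNIV \<pi>) ` {a. a \<subseteq># image_mset \<pi> m} \<subseteq> {a. a \<subseteq># m}"
  proof clarsimp
    fix a assume "a \<subseteq># image_mset \<pi> m"
    then have "image_mset (inv_into UNIV \<pi>) a \<subseteq># image_mset (inv_into UNIV \<pi>) (image_mset \<pi> m)"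
      by (rule image_mset_subseteq_mono)
    then show "image_mset (inv_into UNIV \<pi>) a \<subseteq># m"
      by (simp add: multiset.map_comp o_def i)
  qed
qed

lemma finite_submultisets: "finite {a. a \<subseteq># (m :: 'a multiset)}"
proof (rule finite_subset)
  show "{a. a \<subseteq># m} \<subseteq> (\<Union>k\<le>size m. {a. set_mset a \<subseteq> set_mset m \<and> size a = k})"
    by (auto dest: set_mset_mono size_mset_mono)
  show "finite (\<Union>k\<le>size m. {a. set_mset a \<subseteq> set_mset m \<and> size a = k})"
    using finite_multisets_of_size[of "set_mset m"] by (auto simp: multisets_of_size_def)
qed

instantiation symfun :: comm_ring_1
begin

lift_definition zero_symfun :: symfun is "\<lambda>_. 0"
  by (simp add: symmetric_series_def bounded_degree_def)

lift_definition one_symfun :: symfun is "\<lambda>m. if m = {#} then 1 else 0"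
  by (auto simp: symmetric_series_def bounded_degree_def)

lift_definition plus_symfun :: "symfun \<Rightarrow> symfun \<Rightarrow> symfun" is "\<lambda>f g m. f m + g m"
proof -
  fix f g :: "nat multiset \<Rightarrow> rat"
  assume *: "symmetric_series f \<and> bounded_degree f"
    "symmetric_series g \<and> bounded_degree g"
  then obtain d e where "\<And>m. size m > d \<Longrightarrow> f m = 0" "\<And>m. size m > e \<Longrightarrow> g m = 0"
    by (auto simp: bounded_degree_def)
  then have "\<forall>m. size m > max d e \<longrightarrow> f m + g m = 0" by simp
  then have "bounded_degree (\<lambda>m. f m + g m)" unfolding bounded_degree_def by blast
  moreover have "symmetric_series (\<lambda>m. f m + g m)"
    using * by (simp add: symmetric_series_def)
  ultimately show "symmetric_series (\<lambda>m. f m + g m) \<and> bounded_degree (\<lambda>m. f m + g m)" by simp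
qed

lift_definition uminus_symfun :: "symfun \<Rightarrow> symfun" is "\<lambda>f m. - f m"
  by (auto simp: symmetric_series_def bounded_degree_def)

definition minus_symfun :: "symfun \<Rightarrow> symfun \<Rightarrow> symfun" where
  "minus_symfun f g = f + - g"

lift_definition times_symfun :: "symfun \<Rightarrow> symfun \<Rightarrow> symfun" is
  "\<lambda>f g m. \<Sum>a | a \<subseteq># m. f a * g (m - a)"
proof -
  fix f g :: "nat multiset \<Rightarrow> rat"
  let ?h = "\<lambda>m. \<Sum>a | a \<subseteq># m. f a * g (m - a)"
  assume *: "symmetric_series f \<and> bounded_degree f"
    "symmetric_series g \<and> bounded_degree g"
  then obtain d e where d: "\<And>m. size m > d \<Longrightarrow> f m = 0" and e: "\<And>m. size m > e \<Longrightarrow> g m = 0"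
    by (auto simp: bounded_degree_def)
  have "?h m = 0" if "size m > d + e" for m
  proof (rule sum.neutral, clarsimp)
    fix a assume a: "a \<subseteq># m" "g (m - a) \<noteq> 0"
    then have "size (m - a) \<le> e" using e not_le_imp_less by blast
    with a that have "size a > d" by (simp add: size_Diff_submset)
    then show "f a = 0" by (rule d)
  qed
  then have "bounded_degree ?h" unfolding bounded_degree_def by blast
  moreover have "?h (image_mset \<pi> m) = ?h m" if "finite S" "\<pi> permutes S" for \<pi> S m
  proof -
    have "?h (image_mset \<pi> m)
        = (\<Sum>a | a \<subseteq># m. f (image_mset \<pi> a) * g (image_mset \<pi> m - image_mset \<pi> a))"
      by (rule sum.reindex_bij_betw[OF bij_betw_permuted_submultisets[OF that(2)], symmetric])
    also have "\<dots> = (\<Sum>a | a \<subseteq># m. f (image_mset \<pi> a) * g (image_mset \<pi> (m - a)))"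
      by (intro sum.cong refl) (simp add: image_mset_Diff)
    also have "\<dots> = ?h m"
      using * that by (simp add: symmetric_series_def)
    finally show ?thesis .
  qed
  ultimately show "symmetric_series ?h \<and> bounded_degree ?h"
    by (auto simp: symmetric_series_def)
qed

instance
proof
  fix f g h :: symfun
  show "f + g + h = f + (g + h)" by transfer (simp add: add.assoc)
  show "f + g = g + f" by transfer (simp add: add.commute)
  show "0 + f = f" by transfer simp
  show "- f + f = 0" by transfer simp
  show "f - g = f + - g" by (simp add: minus_symfun_def)
  show "(0::symfun) \<noteq> 1"
    by transfer (metis zero_neq_one)
  show "(f + g) * h = f * h + g * h"
    by transfer (simp add: distrib_right sum.distrib)
  show "1 * f = f"
  proof (rule symfun_eqI)
    fix m
    have "scoeff (1 * f) m = (\<Sum>a | a \<subseteq># m. if a = {#} then scoeff f m else 0)"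
      unfolding times_symfun.rep_eq one_symfun.rep_eq by (intro sum.cong) auto
    also have "\<dots> = scoeff f m"
      using finite_submultisets[of m] by (simp add: sum.delta)
    finally show "scoeff (1 * f) m = scoeff f m" .
  qed
  show "f * g = g * f"
  proof (rule symfun_eqI)
    fix m
    have "bij_betw (\<lambda>a. m - a) {a :: nat multiset. a \<subseteq># m} {a. a \<subseteq># m}"
      by (rule bij_betw_byWitness[where f' = "\<lambda>a. m - a"])
        (auto simp: subset_mset.diff_diff_right)
    then have "(\<Sum>a | a \<subseteq># m. scoeff f a * scoeff g (m - a))
        = (\<Sum>a | a \<subseteq># m. scoeff f (m - a) * scoeff g (m - (m - a)))"
      by (rule sum.reindex_bij_betw[symmetric])
    also have "\<dots> = (\<Sum>a | a \<subseteq># m. scoeff g a * scoeff f (m - a))"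
      by (intro sum.cong) (auto simp: subset_mset.diff_diff_right mult.commute)
    finally show "scoeff (f * g) m = scoeff (g * f) m"
      by (simp add: times_symfun.rep_eq)
  qed
  show "f * g * h = f * (g * h)"
  proof (rule symfun_eqI)
    fix m
    let ?t = "\<lambda>a b. scoeff f a * scoeff g b * scoeff h (m - (a + b))"
    have "scoeff (f * g * h) m
        = (\<Sum>(c, a)\<in>(SIGMA c:{c. c \<subseteq># m}. {a. a \<subseteq># c}). ?t a (c - a))"
      unfolding times_symfun.rep_eq
      by (subst sum.Sigma[symmetric])
        (auto simp: finite_submultisets sum_distrib_right intro!: sum.cong)
    also have "\<dots> = (\<Sum>(a, b)\<in>(SIGMA a:{a. a \<subseteq># m}. {b. b \<subseteq># m - a}). ?t a b)"
      by (rule sum.reindex_bij_witness[where i = "\<lambda>(a, b). (a + b, a)" and j = "\<lambda>(c, a). (a, c - a)"])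
        (auto simp: subseteq_mset_def le_diff_conv2 add.commute multiset_eq_iff,
          (meson le_trans diff_le_mono)+)
    also have "\<dots> = scoeff (f * (g * h)) m"
      unfolding times_symfun.rep_eq
      by (subst sum.Sigma[symmetric])
        (auto simp: finite_submultisets sum_distrib_left mult.assoc intro!: sum.cong)
    finally show "scoeff (f * g * h) m = scoeff (f * (g * h)) m" .
  qed
qed

end

text \<open>\<open>h\<^sub>k\<close> is the sum of all monomials of degree \<open>k\<close>.\<close>

lift_definition complete_sym :: "nat \<Rightarrow> symfun" is "\<lambda>k m. if size m = k then 1 else 0"
  by (auto simp: symmetric_series_def bounded_degree_def)

text \<open>
  For \<open>n > 0\<close>, \<open>power_sum_plethysm n f\<close> is \<open>p\<^sub>n \<circ> f = f(x\<^sub>0\<^sup>n, x\<^sub>1\<^sup>n, \<dots>)\<close>: the substitution turns the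
  monomial \<open>m'\<close> into \<open>repeat_mset n m'\<close>, and at most one \<open>m'\<close> contributes to each coefficient.
\<close>

lift_definition power_sum_plethysm :: "nat \<Rightarrow> symfun \<Rightarrow> symfun" is
  "\<lambda>n f m. \<Sum>m' | repeat_mset n m' = m. f m'"
proof -
  fix n and f :: "nat multiset \<Rightarrow> rat"
  let ?h = "\<lambda>m. \<Sum>m' | repeat_mset n m' = m. f m'"
  assume *: "symmetric_series f \<and> bounded_degree f"
  then obtain d where d: "\<And>m. size m > d \<Longrightarrow> f m = 0" by (auto simp: bounded_degree_def)
  have "?h m = 0" if "size m > n * d" for m
    using that by (intro sum.neutral) (auto intro!: d)
  then have "bounded_degree ?h" unfolding bounded_degree_def by blast
  moreover have "?h (image_mset \<pi> m) = ?h m" if "finite S" "\<pi> permutes S" for \<pi> S m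
  proof -
    have i: "inv_into UNIV \<pi> (\<pi> x) = x" "\<pi> (inv_into UNIV \<pi> x) = x" for x
      using that permutes_inverses by metis+
    have r: "image_mset p (repeat_mset n m') = repeat_mset n (image_mset p m')"
      for p :: "nat \<Rightarrow> nat" and m' by (induction n) auto
    have "bij_betw (image_mset \<pi>) {m'. repeat_mset n m' = m}
        {m'. repeat_mset n m' = image_mset \<pi> m}"
      by (rule bij_betw_byWitness[where f' = "image_mset (inv_into UNIV \<pi>)"])
        (auto simp: multiset.map_comp o_def i r[symmetric])
    then have "?h (image_mset \<pi> m) = (\<Sum>m' | repeat_mset n m' = m. f (image_mset \<pi> m'))"
      by (rule sum.reindex_bij_betw[symmetric])
    also have "\<dots> = ?h m" using * that by (simp add: symmetric_series_def)
    finally show ?thesis .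
  qed
  ultimately show "symmetric_series ?h \<and> bounded_degree ?h"
    by (auto simp: symmetric_series_def)
qed

text \<open>
  A partition is a weakly decreasing sequence of naturals with finitely many nonzero terms, so
  padding by zeros is built in, and containment of partitions is the pointwise order \<open>\<le>\<close>.
  Parts, rows and columns are numbered from 0; a box is a pair (row, column).
\<close>

definition is_partition :: "(nat \<Rightarrow> nat) \<Rightarrow> bool" where
  "is_partition lam \<longleftrightarrow> antimono lam \<and> finite {i. lam i \<noteq> 0}"

definition num_parts :: "(nat \<Rightarrow> nat) \<Rightarrow> nat" where
  "num_parts lam = card {i. lam i \<noteq> 0}"

definition part_size :: "(nat \<Rightarrow> nat) \<Rightarrow> nat" where
  "part_size lam = (\<Sum>i | lam i \<noteq> 0. lam i)"

definition diagram :: "(nat \<Rightarrow> nat) \<Rightarrow> (nat \<times> nat) set" where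
  "diagram lam = {(i, j). j < lam i}"

text \<open>Tableaux are extended by 0 outside the diagram, so that each filling is counted once.\<close>

definition semistandard :: "(nat \<Rightarrow> nat) \<Rightarrow> (nat \<times> nat \<Rightarrow> nat) \<Rightarrow> bool" where
  "semistandard lam T \<longleftrightarrow>
     (\<forall>i j j'. j \<le> j' \<longrightarrow> j' < lam i \<longrightarrow> T (i, j) \<le> T (i, j')) \<and>
     (\<forall>i i' j. i < i' \<longrightarrow> j < lam i' \<longrightarrow> T (i, j) < T (i', j)) \<and>
     (\<forall>b. b \<notin> diagram lam \<longrightarrow> T b = 0)"

definition tableau_content :: "(nat \<Rightarrow> nat) \<Rightarrow> (nat \<times> nat \<Rightarrow> nat) \<Rightarrow> nat multiset" where
  "tableau_content lam T = image_mset T (mset_set (diagram lam))"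

lemma partition_eventually_zero:
  assumes "is_partition lam"
  obtains N where "\<And>i. i \<ge> N \<Longrightarrow> lam i = 0"
proof -
  have "finite {i. lam i \<noteq> 0}" using assms by (simp add: is_partition_def)
  then obtain N where "\<And>i. lam i \<noteq> 0 \<Longrightarrow> i < N"
    using finite_nat_set_iff_bounded by auto
  then show ?thesis using that by (metis not_less)
qed

lemma finite_diagram:
  assumes "is_partition lam" shows "finite (diagram lam)"
proof -
  have "diagram lam = (SIGMA i:{i. lam i \<noteq> 0}. {..<lam i})"
    by (auto simp: diagram_def)
  then show ?thesis using assms by (simp add: is_partition_def)
qed

lemma finite_partitions_of: "finite {lam. is_partition lam \<and> part_size lam = s \<and> P lam}"
proof (rule finite_subset)
  let ?F = "{f. \<forall>i. (i \<in> {..<s} \<longrightarrow> f i \<in> {..s}) \<and> (i \<notin> {..<s} \<longrightarrow> f i = (0::nat))}"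
  show "finite ?F" by (rule finite_set_of_finite_funs) auto
  show "{lam. is_partition lam \<and> part_size lam = s \<and> P lam} \<subseteq> ?F"
  proof (clarsimp, intro conjI impI)
    fix lam i assume p: "is_partition lam" and s: "s = part_size lam"
    have fin: "finite {i. lam i \<noteq> 0}" and mono: "antimono lam"
      using p by (auto simp: is_partition_def)
    have *: "(\<Sum>i\<in>A. lam i) \<le> part_size lam" if "A \<subseteq> {i. lam i \<noteq> 0}" for A
      unfolding part_size_def by (rule sum_mono2[OF fin that]) auto
    show "lam i \<le> part_size lam" using *[of "{i}"] by (cases "lam i = 0") auto
    show "lam i = 0" if "\<not> i < part_size lam"
    proof (rule ccontr)
      assume "lam i \<noteq> 0"
      then have nz: "lam j \<noteq> 0" if "j \<le> i" for j
        using antimonoD[OF mono that] by linarith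
      have "(\<Sum>j\<le>i. 1) \<le> (\<Sum>j\<le>i. lam j)"
        using nz by (intro sum_mono) (simp add: Suc_leI)
      also have "\<dots> \<le> part_size lam" using nz by (intro *) auto
      finally show False using that by simp
    qed
  qed
qed

text \<open>
  The Bender--Knuth involution, used to show that the Schur functions are symmetric. The number
  of entries \<open>< v\<close> in row \<open>r\<close> is \<open>row_count lam T r v\<close>; the involution only changes the counts
  for \<open>v = i + 1\<close>, reflecting each in the interval allowed by its neighbours.
\<close>

definition row_count :: "(nat \<Rightarrow> nat) \<Rightarrow> (nat \<times> nat \<Rightarrow> nat) \<Rightarrow> nat \<Rightarrow> nat \<Rightarrow> nat" where
  "row_count lam T r v = card {j. j < lam r \<and> T (r, j) < v}"

lemma row_count_unique:
  assumes "\<And>j. j < lam r \<Longrightarrow> T (r, j) < v \<longleftrightarrow> j < c" "c \<le> lam r"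
  shows "row_count lam T r v = c"
proof -
  have "{j. j < lam r \<and> T (r, j) < v} = {..<c}" using assms by auto
  then show ?thesis by (simp add: row_count_def)
qed

lemma row_count_le: "row_count lam T r v \<le> lam r"
proof -
  have "row_count lam T r v \<le> card {..<lam r}"
    unfolding row_count_def by (rule card_mono) auto
  then show ?thesis by simp
qed

lemma row_count_mono: "v \<le> w \<Longrightarrow> row_count lam T r v \<le> row_count lam T r w"
  unfolding row_count_def by (rule card_mono) auto

lemma semistandard_less_iff:
  assumes "semistandard lam T" "j < lam r"
  shows "T (r, j) < v \<longleftrightarrow> j < row_count lam T r v"
proof -
  let ?A = "{j. j < lam r \<and> T (r, j) < v}"
  have fin: "finite ?A" by simp
  have down: "j' \<in> ?A" if "j' \<le> j''" "j'' \<in> ?A" for j' j''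
    using assms(1) that unfolding semistandard_def by (fastforce intro: le_less_trans)
  show ?thesis
  proof
    assume "T (r, j) < v"
    then have "{..j} \<subseteq> ?A" using down assms(2) by auto
    then have "card {..j} \<le> card ?A" using fin by (rule card_mono[rotated])
    then show "j < row_count lam T r v" by (simp add: row_count_def)
  next
    assume *: "j < row_count lam T r v"
    show "T (r, j) < v"
    proof (rule ccontr)
      assume "\<not> T (r, j) < v"
      then have "?A \<subseteq> {..<j}" using down by (metis (mono_tags, lifting) lessThan_iff
          mem_Collect_eq not_less subsetI)
      then have "card ?A \<le> card {..<j}" by (rule card_mono[rotated]) simp
      then show False using * by (simp add: row_count_def)
    qed
  qed
qed

lemma semistandard_interlace:
  assumes "is_partition lam" "semistandard lam T"
  shows "row_count lam T (Suc r) (Suc v) \<le> row_count lam T r v"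
proof -
  have "lam (Suc r) \<le> lam r" using assms(1) by (auto simp: is_partition_def antimono_def)
  moreover have "T (r, j) < T (Suc r, j)" if "j < lam (Suc r)" for j
    using assms(2) that by (auto simp: semistandard_def)
  ultimately show ?thesis
    unfolding row_count_def by (intro card_mono) fastforce+
qed

lemma semistandardI_row_count:
  assumes p: "is_partition lam" and out: "\<And>b. b \<notin> diagram lam \<Longrightarrow> T b = 0"
    and less: "\<And>r j v. j < lam r \<Longrightarrow> T (r, j) < v \<longleftrightarrow> j < c r v"
    and inter: "\<And>r v. c (Suc r) (Suc v) \<le> c r v"
  shows "semistandard lam T"
  unfolding semistandard_def
proof (intro conjI allI impI)
  show "T b = 0" if "b \<notin> diagram lam" for b using that by (rule out)
  show "T (i, j) \<le> T (i, j')" if "j \<le> j'" "j' < lam i" for i j j'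
    using less[of j' i "Suc (T (i, j'))"] less[of j i "Suc (T (i, j'))"] that by simp
  have mono: "lam i' \<le> lam i" if "i \<le> i'" for i i'
    using p that by (auto simp: is_partition_def antimono_def)
  have step: "T (i, j) < T (Suc i, j)" if "j < lam (Suc i)" for i j
    using less[OF that, of "Suc (T (Suc i, j))"] inter[of i "T (Suc i, j)"]
      less[of j i "T (Suc i, j)"] mono[of i "Suc i"] that by simp
  show "T (i, j) < T (i', j)" if "i < i'" "j < lam i'" for i i' j
    using that
  proof (induction i' rule: less_Suc_induct)
    case (1 i) then show ?case by (rule step)
  next
    case (2 i k l)
    then show ?case using mono[of k l] by (meson less_imp_le less_le_trans less_trans)
  qed
qed

lemma count_content:
  assumes p: "is_partition lam" and T: "semistandard lam T" and N: "\<And>i. i \<ge> N \<Longrightarrow> lam i = 0"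
  shows "count (tableau_content lam T) v + (\<Sum>r<N. row_count lam T r v) = (\<Sum>r<N. row_count lam T r (Suc v))"
proof -
  have "count (tableau_content lam T) v = card {b \<in> diagram lam. T b = v}"
    using finite_diagram[OF p] by (simp add: tableau_content_def count_image_mset vimage_def Int_def conj_commute)
  also have "{b \<in> diagram lam. T b = v} = (SIGMA r:{..<N}. {j. j < lam r \<and> T (r, j) = v})"
    using N by (auto simp: diagram_def) (metis not_less not_less_zero)
  also have "card \<dots> = (\<Sum>r<N. card {j. j < lam r \<and> T (r, j) = v})"
    by simp
  finally have "count (tableau_content lam T) v + (\<Sum>r<N. row_count lam T r v)
      = (\<Sum>r<N. card {j. j < lam r \<and> T (r, j) = v} + row_count lam T r v)"
    by (simp add: sum.distrib)
  also have "\<dots> = (\<Sum>r<N. row_count lam T r (Suc v))"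
  proof (rule sum.cong[OF refl])
    fix r
    have "{j. j < lam r \<and> T (r, j) < Suc v} =
        {j. j < lam r \<and> T (r, j) = v} \<union> {j. j < lam r \<and> T (r, j) < v}" by auto
    then show "card {j. j < lam r \<and> T (r, j) = v} + row_count lam T r v = row_count lam T r (Suc v)"
      unfolding row_count_def by (simp add: card_Un_disjoint[symmetric] disjoint_iff)
  qed
  finally show ?thesis .
qed

definition bk_count :: "(nat \<Rightarrow> nat) \<Rightarrow> (nat \<times> nat \<Rightarrow> nat) \<Rightarrow> nat \<Rightarrow> nat \<Rightarrow> nat" where
  "bk_count lam T i r =
     max (row_count lam T r i) (row_count lam T (Suc r) (Suc (Suc i)))
     + (case r of 0 \<Rightarrow> row_count lam T 0 (Suc (Suc i))
        | Suc r' \<Rightarrow> min (row_count lam T r (Suc (Suc i))) (row_count lam T r' i))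
     - row_count lam T r (Suc i)"

definition bender_knuth :: "(nat \<Rightarrow> nat) \<Rightarrow> nat \<Rightarrow> (nat \<times> nat \<Rightarrow> nat) \<Rightarrow> (nat \<times> nat \<Rightarrow> nat)" where
  "bender_knuth lam i T = (\<lambda>(r, j).
     if j < lam r \<and> T (r, j) \<in> {i, Suc i} then (if j < bk_count lam T i r then i else Suc i)
     else T (r, j))"

context
  fixes lam :: "nat \<Rightarrow> nat" and i :: nat and T :: "nat \<times> nat \<Rightarrow> nat"
  assumes p: "is_partition lam" and T: "semistandard lam T"
begin

lemma bk_count_bounds:
  "row_count lam T r i \<le> bk_count lam T i r"
  "row_count lam T (Suc r) (Suc (Suc i)) \<le> bk_count lam T i r"
  "bk_count lam T i r \<le> row_count lam T r (Suc (Suc i))"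
  "bk_count lam T i (Suc r) \<le> row_count lam T r i"
  "bk_count lam T i r + row_count lam T r (Suc i) =
     max (row_count lam T r i) (row_count lam T (Suc r) (Suc (Suc i)))
     + (case r of 0 \<Rightarrow> row_count lam T 0 (Suc (Suc i))
        | Suc r' \<Rightarrow> min (row_count lam T r (Suc (Suc i))) (row_count lam T r' i))"
proof -
  note il = semistandard_interlace[OF p T]
  have m: "row_count lam T r i \<le> row_count lam T r (Suc i)"
    "row_count lam T r (Suc i) \<le> row_count lam T r (Suc (Suc i))" for r
    by (simp_all add: row_count_mono)
  show "row_count lam T r i \<le> bk_count lam T i r"
    "row_count lam T (Suc r) (Suc (Suc i)) \<le> bk_count lam T i r"
    "bk_count lam T i r \<le> row_count lam T r (Suc (Suc i))"
    "bk_count lam T i r + row_count lam T r (Suc i) =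
     max (row_count lam T r i) (row_count lam T (Suc r) (Suc (Suc i)))
     + (case r of 0 \<Rightarrow> row_count lam T 0 (Suc (Suc i))
        | Suc r' \<Rightarrow> min (row_count lam T r (Suc (Suc i))) (row_count lam T r' i))"
    using m[of r] il[of r "Suc i"] il[of "r - 1" i]
    by (auto simp: bk_count_def split: nat.splits)
  show "bk_count lam T i (Suc r) \<le> row_count lam T r i"
    using m[of "Suc r"] il[of "Suc r" "Suc i"] il[of r i]
    by (auto simp: bk_count_def)
qed

lemma bender_knuth_less_iff:
  assumes "j < lam r"
  shows "bender_knuth lam i T (r, j) < v \<longleftrightarrow>
    j < (if v = Suc i then bk_count lam T i r else row_count lam T r v)"
proof -
  note iff = semistandard_less_iff[OF T assms]
  consider "v \<le> i" | "v = Suc i" | "v \<ge> Suc (Suc i)" by linarith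
  then show ?thesis
  proof cases
    case 2
    show ?thesis
      using 2 assms iff[of i] iff[of "Suc (Suc i)"] bk_count_bounds(1,3)[of r]
      by (auto simp: bender_knuth_def)
  qed (use assms iff[of v] in \<open>auto simp: bender_knuth_def\<close>)
qed

lemma semistandard_bender_knuth: "semistandard lam (bender_knuth lam i T)"
proof (rule semistandardI_row_count[OF p _ bender_knuth_less_iff])
  show "bender_knuth lam i T b = 0" if "b \<notin> diagram lam" for b
    using T that by (cases b) (auto simp: bender_knuth_def semistandard_def diagram_def)
  fix r v
  show "(if Suc v = Suc i then bk_count lam T i (Suc r) else row_count lam T (Suc r) (Suc v))
    \<le> (if v = Suc i then bk_count lam T i r else row_count lam T r v)"
    using bk_count_bounds[of r] semistandard_interlace[OF p T, of r v] by auto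
qed

lemma row_count_bender_knuth:
  "row_count lam (bender_knuth lam i T) r v =
     (if v = Suc i then bk_count lam T i r else row_count lam T r v)"
proof (rule row_count_unique[OF bender_knuth_less_iff])
  show "(if v = Suc i then bk_count lam T i r else row_count lam T r v) \<le> lam r"
    using bk_count_bounds(3)[of r] row_count_le[of lam T r] by (auto intro: order_trans)
qed auto

lemma bender_knuth_involution: "bender_knuth lam i (bender_knuth lam i T) = T"
proof -
  have "bk_count lam (bender_knuth lam i T) i r = row_count lam T r (Suc i)" for r
    unfolding bk_count_def[of lam "bender_knuth lam i T"] row_count_bender_knuth
    using bk_count_bounds(5)[of r] by (auto split: nat.splits)
  moreover have "T (r, j) = i \<or> T (r, j) = Suc i \<Longrightarrow> j < lam r \<Longrightarrow>
      (j < row_count lam T r (Suc i)) = (T (r, j) = i)" for r j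
    using semistandard_less_iff[OF T, of j r "Suc i"] by auto
  ultimately show ?thesis
    by (intro ext) (auto simp: bender_knuth_def)
qed

lemma content_bender_knuth:
  "tableau_content lam (bender_knuth lam i T) =
     image_mset (Transposition.transpose i (Suc i)) (tableau_content lam T)"
proof (rule multiset_eqI)
  fix v
  obtain N where N: "\<And>i. i \<ge> N \<Longrightarrow> lam i = 0"
    using partition_eventually_zero[OF p] by blast
  let ?c = "row_count lam T" and ?b = "bk_count lam T i"
  let ?s = "\<lambda>r. case r of 0 \<Rightarrow> ?c 0 (Suc (Suc i)) | Suc r' \<Rightarrow> min (?c r (Suc (Suc i))) (?c r' i)"
  have z: "?c N v = 0" for v using row_count_le[of lam T N v] N by simp
  have sN: "?s N = 0" using z by (cases N) auto
  have "(\<Sum>r<N. ?b r) + (\<Sum>r<N. ?c r (Suc i))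
      = (\<Sum>r<N. max (?c r i) (?c (Suc r) (Suc (Suc i)))) + (\<Sum>r<N. ?s r)"
    unfolding sum.distrib[symmetric] by (rule sum.cong[OF refl bk_count_bounds(5)])
  also have "(\<Sum>r<N. ?s r) = (\<Sum>r<Suc N. ?s r)" using sN by simp
  also have "\<dots> = ?c 0 (Suc (Suc i)) + (\<Sum>r<N. min (?c (Suc r) (Suc (Suc i))) (?c r i))"
    unfolding sum.lessThan_Suc_shift by simp
  also have "(\<Sum>r<N. max (?c r i) (?c (Suc r) (Suc (Suc i)))) + \<dots>
      = ?c 0 (Suc (Suc i)) + (\<Sum>r<N. ?c r i + ?c (Suc r) (Suc (Suc i)))"
  proof -
    have "max x y + min y x = x + y" for x y :: nat by (simp add: max_def min_def)
    then have "(\<Sum>r<N. max (?c r i) (?c (Suc r) (Suc (Suc i))))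
        + (\<Sum>r<N. min (?c (Suc r) (Suc (Suc i))) (?c r i))
        = (\<Sum>r<N. ?c r i + ?c (Suc r) (Suc (Suc i)))"
      unfolding sum.distrib[symmetric] by simp
    then show ?thesis by simp
  qed
  also have "\<dots> = (\<Sum>r<N. ?c r i) + (\<Sum>r<Suc N. ?c r (Suc (Suc i)))"
    unfolding sum.lessThan_Suc_shift by (simp add: sum.distrib)
  also have "\<dots> = (\<Sum>r<N. ?c r i) + (\<Sum>r<N. ?c r (Suc (Suc i)))" using z by simp
  finally have key: "(\<Sum>r<N. ?b r) + (\<Sum>r<N. ?c r (Suc i))
      = (\<Sum>r<N. ?c r i) + (\<Sum>r<N. ?c r (Suc (Suc i)))" .
  have old: "count (tableau_content lam T) v + (\<Sum>r<N. ?c r v) = (\<Sum>r<N. ?c r (Suc v))" for v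
    using p T N by (rule count_content)
  have new: "count (tableau_content lam (bender_knuth lam i T)) v
      + (\<Sum>r<N. row_count lam (bender_knuth lam i T) r v)
      = (\<Sum>r<N. row_count lam (bender_knuth lam i T) r (Suc v))" for v
    using p semistandard_bender_knuth N by (rule count_content)
  have "count (tableau_content lam (bender_knuth lam i T)) v
      = count (tableau_content lam T) (Transposition.transpose i (Suc i) v)"
  proof -
    consider "v = i" | "v = Suc i" | "v \<noteq> i" "v \<noteq> Suc i" by blast
    then show ?thesis
    proof cases
      case 1
      then show ?thesis using key old[of "Suc i"] new[of i]
        by (simp add: row_count_bender_knuth)
    next
      case 2
      then show ?thesis using key old[of i] new[of "Suc i"]
        by (simp add: row_count_bender_knuth)
    next
      case 3
      then show ?thesis using old[of v] new[of v]
        by (simp add: row_count_bender_knuth)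
    qed
  qed
  also have "\<dots> = count (image_mset (Transposition.transpose i (Suc i)) (tableau_content lam T)) v"
  proof -
    have "Transposition.transpose i (Suc i) -` {v} = {Transposition.transpose i (Suc i) v}"
      by (auto simp: Transposition.transpose_def split: if_splits)
    then show ?thesis
      by (cases "Transposition.transpose i (Suc i) v \<in># tableau_content lam T")
        (simp_all add: count_image_mset not_in_iff)
  qed
  finally show "count (tableau_content lam (bender_knuth lam i T)) v = \<dots>" .
qed

end

definition kostka :: "(nat \<Rightarrow> nat) \<Rightarrow> nat multiset \<Rightarrow> nat" where
  "kostka lam m = card {T. semistandard lam T \<and> tableau_content lam T = m}"

lemma kostka_adjacent:
  assumes p: "is_partition lam"
  shows "kostka lam (image_mset (Transposition.transpose i (Suc i)) m) = kostka lam m"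
  unfolding kostka_def
proof (rule bij_betw_same_card[where f = "bender_knuth lam i"],
    rule bij_betw_byWitness[where f' = "bender_knuth lam i"])
  let ?t = "Transposition.transpose i (Suc i)"
  have tt: "image_mset ?t (image_mset ?t m) = m" for m
    by (simp add: multiset.map_comp o_def)
  show "\<forall>T\<in>{T. semistandard lam T \<and> tableau_content lam T = image_mset ?t m}.
      bender_knuth lam i (bender_knuth lam i T) = T"
    "\<forall>T\<in>{T. semistandard lam T \<and> tableau_content lam T = m}.
      bender_knuth lam i (bender_knuth lam i T) = T"
    using bender_knuth_involution[OF p] by auto
  show "bender_knuth lam i ` {T. semistandard lam T \<and> tableau_content lam T = image_mset ?t m}
      \<subseteq> {T. semistandard lam T \<and> tableau_content lam T = m}"
    "bender_knuth lam i ` {T. semistandard lam T \<and> tableau_content lam T = m}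
      \<subseteq> {T. semistandard lam T \<and> tableau_content lam T = image_mset ?t m}"
    using semistandard_bender_knuth[OF p] content_bender_knuth[OF p] tt by auto
qed


lemma kostka_transpose:
  assumes p: "is_partition lam"
  shows "kostka lam (image_mset (Transposition.transpose a (a + Suc d)) m) = kostka lam m"
proof (induction d arbitrary: m)
  case 0 then show ?case using kostka_adjacent[OF p] by simp
next
  case (Suc d)
  let ?b = "a + Suc d"
  let ?u = "Transposition.transpose ?b (Suc ?b)"
  have "Transposition.transpose a (Suc ?b) = ?u \<circ> Transposition.transpose a ?b \<circ> ?u"
    by (auto simp: fun_eq_iff Transposition.transpose_def)
  then have "image_mset (Transposition.transpose a (Suc ?b)) m
      = image_mset ?u (image_mset (Transposition.transpose a ?b) (image_mset ?u m))"
    by (simp add: multiset.map_comp o_assoc)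
  then show ?case using kostka_adjacent[OF p] Suc.IH by simp
qed

lemma kostka_permutes:
  assumes p: "is_partition lam" and "\<pi> permutes S" "finite S"
  shows "kostka lam (image_mset \<pi> m) = kostka lam m"
  using assms(2,3)
proof (induction rule: permutes_induct)
  case id then show ?case by simp
next
  case (swap a b q)
  have *: "kostka lam (image_mset (Transposition.transpose c d) m) = kostka lam m"
    if "c < d" for c d m
    using kostka_transpose[OF p, of c "d - Suc c" m] that by simp
  have "kostka lam (image_mset (Transposition.transpose a b) m) = kostka lam m" for m
    using swap(3) *[of a b m] *[of b a m] by (cases "a < b") (auto simp: transpose_commute)
  then have "kostka lam (image_mset (Transposition.transpose a b) (image_mset q m)) = kostka lam m"
    using swap by simp
  then show ?case by (simp add: multiset.map_comp o_def)
qed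

text \<open>
  The Schur function \<open>s\<^bsub>lam\<^esub>\<close> is the generating function of semistandard tableaux of shape \<open>lam\<close>; the value 0 on
  sequences that are not partitions is a junk value.
\<close>

lift_definition schur :: "(nat \<Rightarrow> nat) \<Rightarrow> symfun" is
  "\<lambda>lam m. if is_partition lam then of_nat (kostka lam m) else 0"
proof -
  fix lam
  let ?f = "\<lambda>m. if is_partition lam then of_nat (kostka lam m) else 0 :: rat"
  have "?f m = 0" if "size m > card (diagram lam)" for m
  proof -
    have "{T. semistandard lam T \<and> tableau_content lam T = m} = {}"
      using that by (auto simp: tableau_content_def)
    then show ?thesis unfolding kostka_def by (simp del: Collect_empty_eq)
  qed
  then have "bounded_degree ?f" unfolding bounded_degree_def by blast
  moreover have "symmetric_series ?f"
    by (auto simp: symmetric_series_def kostka_permutes)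
  ultimately show "symmetric_series ?f \<and> bounded_degree ?f" by blast
qed

text \<open>
  The matrix \<open>M(lam/mu)\<close>. Numbering rows and columns from 0 shifts \<open>lam\<^sub>i - i\<close> and \<open>mu\<^sub>j - j\<close> by the same
  amount, so the conditions on the entries are unaffected.
\<close>

definition strip_matrix :: "nat \<Rightarrow> (nat \<Rightarrow> nat) \<Rightarrow> (nat \<Rightarrow> nat) \<Rightarrow> int mat" where
  "strip_matrix n lam mu = mat (num_parts lam) (num_parts lam) (\<lambda>(i, j).
     if int (lam i) - int i \<ge> int (mu j) - int j \<and>
        int n dvd (int (lam i) - int i - int (mu j) + int j)
     then 1 else 0)"

definition skew :: "(nat \<Rightarrow> nat) \<Rightarrow> (nat \<Rightarrow> nat) \<Rightarrow> (nat \<times> nat) set" where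
  "skew lam mu = diagram lam - diagram mu"

fun adjacent :: "nat \<times> nat \<Rightarrow> nat \<times> nat \<Rightarrow> bool" where
  "adjacent (i, j) (i', j') \<longleftrightarrow>
     i = i' \<and> (j' = Suc j \<or> j = Suc j') \<or> j = j' \<and> (i' = Suc i \<or> i = Suc i')"

definition connected_boxes :: "(nat \<times> nat) set \<Rightarrow> bool" where
  "connected_boxes D \<longleftrightarrow>
     (\<forall>b\<in>D. \<forall>c\<in>D. (b, c) \<in> {(x, y). x \<in> D \<and> y \<in> D \<and> adjacent x y}\<^sup>*)"

text \<open>This predicate is only applied to skew diagrams, and only with \<open>r > 0\<close>.\<close>

definition border_strip :: "nat \<Rightarrow> (nat \<times> nat) set \<Rightarrow> bool" where
  "border_strip r D \<longleftrightarrow> finite D \<and> card D = r \<and> connected_boxes D \<and>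
     \<not> (\<exists>i j. {(i, j), (i, Suc j), (Suc i, j), (Suc i, Suc j)} \<subseteq> D)"

definition strip_height :: "(nat \<times> nat) set \<Rightarrow> nat" where
  "strip_height D = card (fst ` D) - 1"

text \<open>The northeasternmost box; rows are numbered from top to bottom.\<close>

definition starting_box :: "(nat \<times> nat) set \<Rightarrow> nat \<times> nat" where
  "starting_box D = (THE b. b \<in> D \<and> (\<forall>c\<in>D. fst b \<le> fst c \<and> snd c \<le> snd b))"

definition top_boxes :: "(nat \<times> nat) set \<Rightarrow> (nat \<times> nat) set" where
  "top_boxes D = {(i, j). (i, j) \<in> D \<and> (\<forall>i'. (i', j) \<in> D \<longrightarrow> i \<le> i')}"

definition southwest :: "nat \<times> nat \<Rightarrow> nat \<times> nat \<Rightarrow> bool" where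
  "southwest b c \<longleftrightarrow> fst c \<le> fst b \<and> snd b < snd c"

text \<open>Here the strip with index \<open>i < k\<close> is \<open>\<alpha>\<^bsup>(i+1)\<^esup>/\<alpha>\<^bsup>(i)\<^esup>\<close>.\<close>

definition strip_chain ::
  "nat \<Rightarrow> nat \<Rightarrow> (nat \<Rightarrow> nat) \<Rightarrow> (nat \<Rightarrow> nat) \<Rightarrow> (nat \<Rightarrow> nat \<Rightarrow> nat) \<Rightarrow> bool" where
  "strip_chain n k lam mu \<alpha> \<longleftrightarrow>
     \<alpha> 0 = mu \<and> \<alpha> k = lam \<and> (\<forall>i\<le>k. is_partition (\<alpha> i)) \<and>
     (\<forall>i<k. \<alpha> i \<le> \<alpha> (Suc i) \<and> border_strip n (skew (\<alpha> (Suc i)) (\<alpha> i)) \<and>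
        starting_box (skew (\<alpha> (Suc i)) (\<alpha> i)) \<in> top_boxes (skew lam mu)) \<and>
     (\<forall>i j. i < j \<longrightarrow> j < k \<longrightarrow>
        southwest (starting_box (skew (\<alpha> (Suc i)) (\<alpha> i))) (starting_box (skew (\<alpha> (Suc j)) (\<alpha> j))))"

definition horizontal_border_strip ::
  "nat \<Rightarrow> nat \<Rightarrow> (nat \<Rightarrow> nat) \<Rightarrow> (nat \<Rightarrow> nat) \<Rightarrow> bool" where
  "horizontal_border_strip n k lam mu \<longleftrightarrow> (\<exists>\<alpha>. strip_chain n k lam mu \<alpha>)"

text \<open>
  The terms \<open>\<alpha> 0, \<dots>, \<alpha> k\<close> of a chain are unique if a chain exists; \<open>SOME\<close> is used because
  the values of \<open>\<alpha>\<close> beyond \<open>k\<close> are arbitrary. They do not enter the product.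
\<close>

definition strip_sign :: "nat \<Rightarrow> nat \<Rightarrow> (nat \<Rightarrow> nat) \<Rightarrow> (nat \<Rightarrow> nat) \<Rightarrow> int" where
  "strip_sign n k lam mu =
     (let \<alpha> = (SOME \<alpha>. strip_chain n k lam mu \<alpha>)
      in \<Prod>i<k. (- 1) ^ strip_height (skew (\<alpha> (Suc i)) (\<alpha> i)))"

end

theory Submission
  imports Defs "HOL-Library.Poly_Mapping" "HOL-Library.Multiset_Order"
begin

text \<open>
  In \<open>N\<close> variables \<open>p\<^sub>n \<circ> h\<^sub>k\<close> is the sum of the monomials \<open>x\<^bsup>n e\<^esup>\<close> with \<open>|e| = k\<close>. Being symmetric, it multiplies
  the alternant with exponents \<open>l\<close> to the sum of the alternants with exponents \<open>l + n e\<close>. For \<open>l = mu + delta\<close>,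
  the alternants with a repeated exponent vanish, and sorting the exponents of the others collects
  the Leibniz expansion of \<open>det M(lam/mu)\<close> as the coefficient of the alternant of \<open>lam + delta\<close>. Dividing by the
  alternant of \<open>delta\<close> gives the product formula, since tableaux and alternants satisfy the same branching
  rule in the number of variables.

  For the value of the determinant, encode \<open>lam\<close> by the numbers \<open>lam\<^sub>i - i\<close>. Adding an \<open>n\<close>-border strip
  increases one of them by \<open>n\<close> and overtakes as many others as the height of the strip. A chain of strips with
  increasing starting boxes therefore yields a matching of the numbers of \<open>lam\<close> with those of \<open>mu\<close> that
  interlaces within each residue class modulo \<open>n\<close>, and permuting the columns of the matrix by it
  makes the matrix unitriangular. Conversely, a matrix without zero rows or equal rows has such a
  matching, and undoing its moves from the largest one down recovers a chain.
\<close>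

subsection \<open>Determinants and alternants\<close>

lemma det_mat_Leibniz:
  "det (mat N N (\<lambda>(i, j). f i j)) =
     (\<Sum>p | p permutes {0..<N}. signof p * (\<Prod>i = 0..<N. f i (p i)))"
proof -
  have "det (mat N N (\<lambda>(i, j). f i j)) =
     (\<Sum>p | p permutes {0..<N}. signof p * (\<Prod>i = 0..<N. mat N N (\<lambda>(i, j). f i j) $$ (i, p i)))"
    by (rule det_def') simp
  also have "\<dots> = (\<Sum>p | p permutes {0..<N}. signof p * (\<Prod>i = 0..<N. f i (p i)))"
  proof (intro sum.cong prod.cong refl arg_cong2[where f = "(*)"])
    fix p i assume "p \<in> {p. p permutes {0..<N}}" "i \<in> {0..<N}"
    then have "p i \<in> {0..<N}" by (simp only: mem_Collect_eq permutes_in_image)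
    with \<open>i \<in> {0..<N}\<close> show "mat N N (\<lambda>(i, j). f i j) $$ (i, p i) = f i (p i)" by simp
  qed
  finally show ?thesis .
qed

lemma det_scale_columns:
  "det (mat N N (\<lambda>(i, j). d j * f i j)) = (\<Prod>j = 0..<N. d j) * det (mat N N (\<lambda>(i, j). f i j))"
proof -
  have *: "(\<Prod>i = 0..<N. d (p i)) = (\<Prod>j = 0..<N. d j)" if "p permutes {0..<N}" for p
    using prod.permute[OF that, of d] by (simp add: o_def)
  show ?thesis
    unfolding det_mat_Leibniz sum_distrib_left
    by (intro sum.cong refl) (simp add: prod.distrib * mult_ac)
qed

lemma det_last_column:
  fixes f :: "nat \<Rightarrow> nat \<Rightarrow> 'a::idom"
  assumes "\<And>i. i < N \<Longrightarrow> f i N = 0"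
  shows "det (mat (Suc N) (Suc N) (\<lambda>(i, j). f i j)) = f N N * det (mat N N (\<lambda>(i, j). f i j))"
proof -
  let ?A = "mat (Suc N) (Suc N) (\<lambda>(i, j). f i j)"
  have "det ?A = (\<Sum>i<Suc N. ?A $$ (i, N) * cofactor ?A i N)"
    by (rule laplace_expansion_column) auto
  also have "\<dots> = f N N * cofactor ?A N N"
    using assms by simp
  also have "mat_delete ?A N N = mat N N (\<lambda>(i, j). f i j)"
    by (intro eq_matI) (auto simp: mat_delete_def)
  then have "cofactor ?A N N = det (mat N N (\<lambda>(i, j). f i j))"
    by (simp add: cofactor_def flip: power_mult_distrib mult_2)
  finally show ?thesis .
qed

lemma det_mat_transpose:
  fixes f :: "nat \<Rightarrow> nat \<Rightarrow> 'a::idom"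
  shows "det (mat N N (\<lambda>(i, j). f j i)) = det (mat N N (\<lambda>(i, j). f i j))"
proof -
  have "transpose_mat (mat N N (\<lambda>(i, j). f i j)) = mat N N (\<lambda>(i, j). f j i)"
    by (intro eq_matI) auto
  then show ?thesis using det_transpose[of "mat N N (\<lambda>(i, j). f i j)" N] by simp
qed

lemma det_last_row:
  fixes f :: "nat \<Rightarrow> nat \<Rightarrow> 'a::idom"
  assumes "\<And>j. j < N \<Longrightarrow> f N j = 0"
  shows "det (mat (Suc N) (Suc N) (\<lambda>(i, j). f i j)) = f N N * det (mat N N (\<lambda>(i, j). f i j))"
  using det_last_column[of N "\<lambda>i j. f j i"] assms by (simp only: det_mat_transpose[of _ f])

lemma det_permute_columns:
  fixes f :: "nat \<Rightarrow> nat \<Rightarrow> 'a::idom"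
  assumes p: "p permutes {0..<N}"
  shows "det (mat N N (\<lambda>(i, j). f i (p j))) = of_int (sign p) * det (mat N N (\<lambda>(i, j). f i j))"
proof -
  let ?A = "mat N N (\<lambda>(i, j). f j i)"
  have "det (mat N N (\<lambda>(i, j). f i (p j))) = det (mat N N (\<lambda>(i, j). f j (p i)))"
    by (rule det_mat_transpose[symmetric])
  also have "mat N N (\<lambda>(i, j). f j (p i)) = mat N N (\<lambda>(i, j). ?A $$ (p i, j))"
    using permutes_in_image[OF p] by (intro eq_matI) auto
  also have "det \<dots> = of_int (sign p) * det ?A" by (rule det_permute_rows[OF _ p]) simp
  also have "det ?A = det (mat N N (\<lambda>(i, j). f i j))" by (rule det_mat_transpose)
  finally show ?thesis .
qed

lemma det_unitriangular:
  fixes f :: "nat \<Rightarrow> nat \<Rightarrow> 'a::idom"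
  assumes "\<And>i. i < N \<Longrightarrow> f i i = 1" "\<And>i j. j < i \<Longrightarrow> i < N \<Longrightarrow> f i j = 0"
  shows "det (mat N N (\<lambda>(i, j). f i j)) = 1"
proof -
  have "det (mat N N (\<lambda>(i, j). f i j)) = prod_list (diag_mat (mat N N (\<lambda>(i, j). f i j)))"
    by (rule det_upper_triangular[where n = N]) (use assms(2) in auto)
  then show ?thesis using assms(1) by (simp add: prod_list_diag_prod)
qed

text \<open>The row operations all use the original rows, so together they are left multiplication
  by the upper unitriangular matrix \<open>?U\<close> with the entries \<open>- c i\<close> just
  above the diagonal.\<close>

lemma det_subtract_next_row:
  fixes f :: "nat \<Rightarrow> nat \<Rightarrow> 'a::idom"
  shows "det (mat (Suc N) (Suc N) (\<lambda>(i, j). f i j)) =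
    det (mat (Suc N) (Suc N) (\<lambda>(i, j). if i < N then f i j - c i * f (Suc i) j else f i j))"
proof -
  let ?A = "mat (Suc N) (Suc N) (\<lambda>(i, j). f i j)"
  let ?B = "mat (Suc N) (Suc N) (\<lambda>(i, j). if i < N then f i j - c i * f (Suc i) j else f i j)"
  let ?u = "\<lambda>i j. if i = j then 1 else if j = Suc i then - c i else 0"
  let ?U = "mat (Suc N) (Suc N) (\<lambda>(i, j). ?u i j)"
  have "upper_triangular ?U" by auto
  then have "det ?U = prod_list (diag_mat ?U)" by (rule det_upper_triangular[where n = "Suc N"]) simp
  also have "\<dots> = 1" by (simp add: prod_list_diag_prod)
  finally have U: "det ?U = 1" .
  have "?U * ?A = ?B"
  proof (rule eq_matI)
    fix i j assume "i < dim_row ?B"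
      "j < dim_col ?B"
    then have ij: "i < Suc N" "j < Suc N" by auto
    then have "(?U * ?A) $$ (i, j) = (\<Sum>k = 0..<Suc N. ?u i k * f k j)"
      by (simp add: scalar_prod_def del: sum.op_ivl_Suc)
    also have "\<dots> = (\<Sum>k = 0..<Suc N. (if i = k then f i j else 0) + (if Suc i = k then - c i * f (Suc i) j else 0))"
      by (rule sum.cong) auto
    also have "\<dots> = f i j + (if Suc i < Suc N then - c i * f (Suc i) j else 0)"
      unfolding sum.distrib using ij by (simp del: sum.op_ivl_Suc add: sum.delta')
    also have "\<dots> = ?B $$ (i, j)"
      using ij by auto
    finally show "(?U * ?A) $$ (i, j) = \<dots>" .
  qed auto
  then have "det ?B = det (?U * ?A)"
    by simp
  also have "\<dots> = det ?U * det ?A" by (rule det_mult[where n = "Suc N"]) auto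
  finally show ?thesis by (simp add: U)
qed

section \<open>Alternants with arbitrary exponents\<close>

definition alternant :: "nat \<Rightarrow> (nat \<Rightarrow> 'a::idom) \<Rightarrow> (nat \<Rightarrow> nat) \<Rightarrow> 'a" where
  "alternant N x l = det (mat N N (\<lambda>(i, j). x j ^ l i))"

lemma alternant_cong:
  assumes "\<And>i. i < N \<Longrightarrow> l i = l' i"
  shows "alternant N x l = alternant N x l'"
  unfolding alternant_def by (rule arg_cong[where f = det], rule eq_matI) (simp_all add: assms)

lemma alternant_permute:
  assumes p: "p permutes {0..<N}"
  shows "alternant N x (l \<circ> p) = signof p * alternant N x l"
proof -
  let ?A = "mat N N (\<lambda>(i, j). x j ^ l i)"
  have "mat N N (\<lambda>(i, j). x j ^ (l \<circ> p) i) = mat N N (\<lambda>(i, j). ?A $$ (p i, j))"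
    using permutes_in_image[OF p] by (intro eq_matI) auto
  then show ?thesis
    unfolding alternant_def using det_permute_rows[OF _ p, of ?A] by simp
qed

lemma alternant_eq_0:
  assumes "\<not> inj_on l {0..<N}"
  shows "alternant N x l = 0"
proof -
  obtain i j where ij: "i < N" "j < N" "i \<noteq> j" "l i = l j"
    using assms by (auto simp: inj_on_def)
  show ?thesis
    unfolding alternant_def
    by (rule det_identical_rows[OF _ ij(3,1,2)]) (use ij in \<open>auto intro!: eq_vecI\<close>)
qed

text \<open>Multilinearity in the rows: each \<open>v\<close> selects one monomial from the sum in
  every row.\<close>

lemma det_sum_monomials:
  assumes "\<And>i. i < N \<Longrightarrow> finite (A i)"
  shows "det (mat N N (\<lambda>(i, j). \<Sum>v\<in>A i. c i v * x j ^ e i v)) =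
    (\<Sum>v\<in>PiE {0..<N} A. (\<Prod>i = 0..<N. c i (v i)) * alternant N x (\<lambda>i. e i (v i)))"
proof -
  have "det (mat N N (\<lambda>(i, j). \<Sum>v\<in>A i. c i v * x j ^ e i v)) =
    (\<Sum>p | p permutes {0..<N}. \<Sum>v\<in>PiE {0..<N} A.
       signof p * (\<Prod>i = 0..<N. c i (v i) * x (p i) ^ e i (v i)))"
    unfolding det_mat_Leibniz
    by (intro sum.cong refl) (subst prod_sum_PiE, use assms in \<open>auto simp: sum_distrib_left\<close>)
  also have "\<dots> = (\<Sum>v\<in>PiE {0..<N} A. \<Sum>p | p permutes {0..<N}.
       signof p * (\<Prod>i = 0..<N. c i (v i) * x (p i) ^ e i (v i)))"
    by (rule sum.swap)
  also have "\<dots> = (\<Sum>v\<in>PiE {0..<N} A. (\<Prod>i = 0..<N. c i (v i)) * alternant N x (\<lambda>i. e i (v i)))"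
    unfolding alternant_def det_mat_Leibniz sum_distrib_left
    by (intro sum.cong refl) (simp add: prod.distrib mult_ac)
  finally show ?thesis .
qed

section \<open>Branching of alternants in the number of variables\<close>

text \<open>This is \<open>lam + delta\<close> for the staircase
  \<open>delta = (N - 1, ..., 1, 0)\<close>; only the indices \<open>i < N\<close> are
  meaningful.\<close>

definition shifted :: "nat \<Rightarrow> (nat \<Rightarrow> nat) \<Rightarrow> nat \<Rightarrow> nat" where
  "shifted N lam i = lam i + (N - Suc i)"

text \<open>The sum keeps an interval of exponents because \<open>v\<close> will become a part of a
  partition that lies between two consecutive parts of \<open>lam\<close>.\<close>

lemma geometric_interval:
  fixes y z :: "'a::idom"
  assumes "b \<le> a"
  shows "(y - z) * (\<Sum>v = b..a. z ^ (a - v) * y ^ v) = y ^ Suc a - z ^ (Suc a - b) * y ^ b"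
  using assms
proof (induction rule: dec_induct)
  case base
  then show ?case by (simp add: algebra_simps)
next
  case (step a)
  have "(\<Sum>v = b..Suc a. z ^ (Suc a - v) * y ^ v) = z * (\<Sum>v = b..a. z ^ (a - v) * y ^ v) + y ^ Suc a"
    using step(1) unfolding sum_distrib_left
    by (auto simp: Suc_diff_le mult_ac intro!: sum.cong)
  then have "(y - z) * (\<Sum>v = b..Suc a. z ^ (Suc a - v) * y ^ v) =
      z * ((y - z) * (\<Sum>v = b..a. z ^ (a - v) * y ^ v)) + (y - z) * y ^ Suc a"
    by (simp add: algebra_simps)
  also have "\<dots> = y ^ Suc (Suc a) - z ^ (Suc (Suc a) - b) * y ^ b"
    unfolding step.IH using step(1) by (simp add: algebra_simps Suc_diff_le)
  finally show ?case .
qed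

text \<open>Subtracting from each row a multiple of the next one clears the last column.\<close>

lemma alternant_branch:
  fixes x :: "nat \<Rightarrow> 'a::idom"
  assumes lam: "antimono lam"
  shows "alternant (Suc N) x (shifted (Suc N) lam) = (\<Prod>j = 0..<N. x j - x N) *
    (\<Sum>nu\<in>PiE {0..<N} (\<lambda>i. {lam (Suc i)..lam i}).
       x N ^ (lam N + (\<Sum>i = 0..<N. lam i - nu i)) * alternant N x (shifted N nu))"
proof -
  let ?l = "shifted (Suc N) lam"
  \<comment> \<open>This multiplier makes the entry in column \<open>N\<close> of each row
    \<open>i < N\<close> cancel.\<close>
  let ?c = "\<lambda>i. x N ^ (?l i - ?l (Suc i))"
  let ?g = "\<lambda>i j. if i < N then x j ^ ?l i - ?c i * x j ^ ?l (Suc i) else x j ^ ?l i"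
  have mono: "lam (Suc i) \<le> lam i" for i using lam by (simp add: antimono_def)
  have "alternant (Suc N) x ?l = det (mat (Suc N) (Suc N) (\<lambda>(i, j). ?g i j))"
    unfolding alternant_def by (rule det_subtract_next_row)
  also have "\<dots> = ?g N N * det (mat N N (\<lambda>(i, j). ?g i j))"
  proof (rule det_last_column)
    fix i assume "i < N"
    moreover have "?l (Suc i) \<le> ?l i" using mono[of i] by (simp add: shifted_def)
    ultimately show "?g i N = 0" by (simp flip: power_add)
  qed
  also have "?g N N = x N ^ lam N" by (simp add: shifted_def)
  also have "mat N N (\<lambda>(i, j). ?g i j) = mat N N (\<lambda>(i, j). (x j - x N) *
      (\<Sum>v = lam (Suc i)..lam i. x N ^ (lam i - v) * x j ^ (v + (N - Suc i))))"
  proof -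
    have "?g i j = (x j - x N) *
        (\<Sum>v = lam (Suc i)..lam i. x N ^ (lam i - v) * x j ^ (v + (N - Suc i)))" if i: "i < N" for i j
    proof -
      \<comment> \<open>The staircase shift for \<open>N\<close> variables is split off from both
        exponents. What remains is \<open>Suc (lam i)\<close> and \<open>lam (Suc i)\<close>, the
        ends required by \<open>geometric_interval\<close>.\<close>
      have l: "?l i = Suc (lam i) + (N - Suc i)" "?l (Suc i) = lam (Suc i) + (N - Suc i)"
        "?l i - ?l (Suc i) = Suc (lam i) - lam (Suc i)"
        using i mono[of i] by (auto simp: shifted_def)
      show ?thesis
        unfolding l if_P[OF i] power_add mult.assoc[symmetric] sum_distrib_right[symmetric]
          geometric_interval[OF mono]
        by (simp add: algebra_simps)
    qed
    then show ?thesis by (intro cong_mat refl) (simp only: prod.case)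
  qed
  \<comment> \<open>The factors \<open>x j - x N\<close> belong to columns and come out first;
    expanding the rows then chooses one \<open>nu i\<close> per row, which is an interlacing
    sequence.\<close>
  also have "det \<dots> = (\<Prod>j = 0..<N. x j - x N) * (\<Sum>nu\<in>PiE {0..<N} (\<lambda>i. {lam (Suc i)..lam i}).
      (\<Prod>i = 0..<N. x N ^ (lam i - nu i)) * alternant N x (\<lambda>i. nu i + (N - Suc i)))"
    unfolding det_scale_columns by (subst det_sum_monomials) auto
  also have "(\<lambda>i. nu i + (N - Suc i)) = shifted N nu" for nu
    by (auto simp: shifted_def fun_eq_iff)
  then have "(\<Sum>nu\<in>PiE {0..<N} (\<lambda>i. {lam (Suc i)..lam i}).
      (\<Prod>i = 0..<N. x N ^ (lam i - nu i)) * alternant N x (\<lambda>i. nu i + (N - Suc i))) =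
    (\<Sum>nu\<in>PiE {0..<N} (\<lambda>i. {lam (Suc i)..lam i}).
      x N ^ (\<Sum>i = 0..<N. lam i - nu i) * alternant N x (shifted N nu))"
    by (simp only: power_sum)
  finally show ?thesis
    by (simp only: power_add sum_distrib_left mult.left_commute[of "x N ^ lam N"] mult.assoc)
qed

subsection \<open>Tableaux and the bialternant formula\<close>

definition tableaux :: "nat \<Rightarrow> (nat \<Rightarrow> nat) \<Rightarrow> (nat \<times> nat \<Rightarrow> nat) set" where
  "tableaux N lam = {T. semistandard lam T \<and> (\<forall>b\<in>diagram lam. T b < N)}"

text \<open>The variables are any family in an integral domain; formal variables are substituted
  only when coefficients are compared.\<close>

definition schur_poly :: "nat \<Rightarrow> (nat \<Rightarrow> 'a::idom) \<Rightarrow> (nat \<Rightarrow> nat) \<Rightarrow> 'a" where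
  "schur_poly N x lam = (\<Sum>T\<in>tableaux N lam. \<Prod>b\<in>diagram lam. x (T b))"

lemma finite_tableaux:
  assumes "is_partition lam"
  shows "finite (tableaux N lam)"
proof (rule finite_subset)
  let ?F = "{T. \<forall>b. (b \<in> diagram lam \<longrightarrow> T b \<in> {..<N}) \<and> (b \<notin> diagram lam \<longrightarrow> T b = (0::nat))}"
  show "tableaux N lam \<subseteq> ?F" by (auto simp: tableaux_def semistandard_def)
  show "finite ?F" by (rule finite_set_of_finite_funs) (auto intro: finite_diagram assms)
qed

lemma is_partitionD: "is_partition lam \<Longrightarrow> i \<le> j \<Longrightarrow> lam j \<le> lam i"
  by (auto simp: is_partition_def antimono_def)

lemma is_partitionI:
  assumes "\<And>i. lam (Suc i) \<le> lam i" "\<And>i. N \<le> i \<Longrightarrow> lam i = 0"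
  shows "is_partition lam"
  unfolding is_partition_def
proof
  show "antimono lam" using assms(1) by (simp add: antimono_iff_le_Suc)
  have "{i. lam i \<noteq> 0} \<subseteq> {..<N}" using assms(2) by (metis (mono_tags) lessThan_iff mem_Collect_eq not_le subsetI)
  then show "finite {i. lam i \<noteq> 0}" by (rule finite_subset) simp
qed

text \<open>Column strictness gives this bound. It shows that no entry below \<open>N\<close> occurs
  in row \<open>N\<close> or later, so cutting shapes at \<open>N\<close> loses nothing.\<close>

lemma semistandard_ge_row:
  assumes "is_partition lam" "semistandard lam T" "c < lam r"
  shows "r \<le> T (r, c)"
  using assms(3)
proof (induction r)
  case (Suc r)
  have "c < lam r" using Suc.prems is_partitionD[OF assms(1), of r "Suc r"] by simp
  moreover have "T (r, c) < T (Suc r, c)" using assms(2) Suc.prems by (auto simp: semistandard_def)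
  ultimately show ?case using Suc.IH by simp
qed simp

section \<open>Removing the largest entry from tableaux\<close>

text \<open>Elements of a \<open>PiE\<close> are \<open>undefined\<close> outside the index set;
  replacing these values by 0 gives a partition.\<close>

definition truncate :: "nat \<Rightarrow> (nat \<Rightarrow> nat) \<Rightarrow> nat \<Rightarrow> nat" where
  "truncate N nu i = (if i < N then nu i else 0)"

context
  fixes lam :: "nat \<Rightarrow> nat" and N :: nat
  assumes lam: "is_partition lam" and zero: "lam (Suc N) = 0"
begin

abbreviation "interlacing \<equiv> PiE {0..<N} (\<lambda>i. {lam (Suc i)..lam i})"

text \<open>The entries below \<open>N\<close> form a smaller tableau; the first component is its
  shape, kept as an element of the \<open>PiE\<close> called \<open>interlacing\<close>.\<close>

definition restrict_tableau :: "(nat \<times> nat \<Rightarrow> nat) \<Rightarrow> (nat \<Rightarrow> nat) \<times> (nat \<times> nat \<Rightarrow> nat)" where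
  "restrict_tableau T = (let nu = restrict (\<lambda>i. row_count lam T i N) {0..<N} in
     (nu, \<lambda>b. if b \<in> diagram (truncate N nu) then T b else 0))"

definition extend_tableau :: "(nat \<Rightarrow> nat) \<times> (nat \<times> nat \<Rightarrow> nat) \<Rightarrow> nat \<times> nat \<Rightarrow> nat" where
  "extend_tableau = (\<lambda>(nu, T) b. if b \<in> diagram (truncate N nu) then T b
     else if b \<in> diagram lam then N else 0)"

lemma truncate_interlacing:
  assumes "nu \<in> interlacing"
  shows "is_partition (truncate N nu)" "truncate N nu i \<le> lam i" "lam (Suc i) \<le> truncate N nu i"
proof -
  have b: "lam (Suc i) \<le> nu i" "nu i \<le> lam i" if "i < N" for i
    using PiE_mem[OF assms, of i] that by auto
  have z: "lam (Suc i) = 0" if "N \<le> i" for i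
    using is_partitionD[OF lam, of "Suc N" "Suc i"] zero that by simp
  have up: "truncate N nu i \<le> lam i" for i using b by (simp add: truncate_def)
  have low: "lam (Suc i) \<le> truncate N nu i" for i using b z by (simp add: truncate_def)
  show "truncate N nu i \<le> lam i" "lam (Suc i) \<le> truncate N nu i" by (rule up, rule low)
  show "is_partition (truncate N nu)"
    by (rule is_partitionI[of _ N]) (use up low order_trans in \<open>blast, simp add: truncate_def\<close>)
qed

lemma extend_tableau:
  assumes nu: "nu \<in> interlacing" and T: "T \<in> tableaux N (truncate N nu)"
  shows "extend_tableau (nu, T) \<in> tableaux (Suc N) lam"
    "\<And>i. i < N \<Longrightarrow> row_count lam (extend_tableau (nu, T)) i N = nu i"
proof -
  let ?nu = "truncate N nu" and ?T = "extend_tableau (nu, T)"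
  note t = truncate_interlacing[OF nu]
  have ss: "semistandard ?nu T" and lt: "\<And>i j. j < ?nu i \<Longrightarrow> T (i, j) < N"
    using T by (auto simp: tableaux_def diagram_def)
  have eval: "?T (i, j) = (if j < ?nu i then T (i, j) else if j < lam i then N else 0)" for i j
    by (simp add: extend_tableau_def diagram_def)
  have "?T (i, j) \<le> ?T (i, j')" if "j \<le> j'" "j' < lam i" for i j j'
    using ss lt[of j i] that unfolding eval semistandard_def by auto
  moreover have "?T (i, j) < ?T (i', j)" if "i < i'" "j < lam i'" for i i' j
  proof -
    \<comment> \<open>Interlacing puts every box that has another one below it into the inner shape,
      so no column receives \<open>N\<close> twice.\<close>
    have "j < ?nu i" using that is_partitionD[OF lam, of "Suc i" i'] t(3)[of i] by linarith
    then show ?thesis using that ss lt[of j i] unfolding eval semistandard_def by auto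
  qed
  moreover have "?T b = 0" if "b \<notin> diagram lam" for b
    using that t(2)[of "fst b"] by (cases b) (auto simp: extend_tableau_def diagram_def)
  moreover have "?T b < Suc N" if "b \<in> diagram lam" for b
    using that lt[of "snd b" "fst b"] by (cases b) (auto simp: eval diagram_def less_Suc_eq)
  ultimately show "?T \<in> tableaux (Suc N) lam"
    unfolding tableaux_def semistandard_def by blast
  show "row_count lam ?T i N = nu i" if "i < N" for i
  proof (rule row_count_unique)
    show "nu i \<le> lam i" using t(2)[of i] that by (simp add: truncate_def)
    show "?T (i, j) < N \<longleftrightarrow> j < nu i" if "j < lam i" for j
      using that \<open>i < N\<close> lt[of j i] unfolding eval by (auto simp: truncate_def)
  qed
qed

lemma restrict_tableau:
  assumes T: "T \<in> tableaux (Suc N) lam" and r: "restrict_tableau T = (nu, T')"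
  shows "nu \<in> interlacing" "T' \<in> tableaux N (truncate N nu)"
    "\<And>i j. j < lam i \<Longrightarrow> j < truncate N nu i \<longleftrightarrow> T (i, j) < N"
proof -
  let ?nu = "truncate N nu"
  have nu: "nu = restrict (\<lambda>i. row_count lam T i N) {0..<N}"
    and T': "T' = (\<lambda>b. if b \<in> diagram ?nu then T b else 0)"
    using r by (auto simp: restrict_tableau_def Let_def)
  have ss: "semistandard lam T" and lt: "\<And>i j. j < lam i \<Longrightarrow> T (i, j) < Suc N"
    using T by (auto simp: tableaux_def diagram_def)
  show inter: "nu \<in> interlacing"
  proof
    fix i assume "i \<in> {0..<N}"
    then have "nu i = row_count lam T i N" by (simp add: nu)
    \<comment> \<open>All entries are at most \<open>N\<close>, so this count is the whole row, and
      the interlacing of counts yields the lower bound on \<open>nu i\<close>.\<close>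
    moreover have "row_count lam T (Suc i) (Suc N) = lam (Suc i)"
      by (rule row_count_unique) (use lt in auto)
    ultimately show "nu i \<in> {lam (Suc i)..lam i}"
      using semistandard_interlace[OF lam ss, of i N] row_count_le[of lam T i N] by auto
  qed (auto simp: nu)
  note t = truncate_interlacing[OF inter]
  show iff: "j < ?nu i \<longleftrightarrow> T (i, j) < N" if "j < lam i" for i j
  proof (cases "i < N")
    case True
    then show ?thesis using semistandard_less_iff[OF ss that, of N] by (simp add: truncate_def nu)
  next
    case False
    then show ?thesis using semistandard_ge_row[OF lam ss that] by (simp add: truncate_def)
  qed
  have le: "j < lam i" if "j < ?nu i" for i j using that t(2)[of i] by simp
  have "semistandard ?nu T'"
    unfolding semistandard_def
  proof (intro conjI allI impI)
    show "T' (i, j) \<le> T' (i, j')" if "j \<le> j'" "j' < ?nu i" for i j j'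
      using that le[of j' i] ss by (auto simp: T' diagram_def semistandard_def)
    show "T' (i, j) < T' (i', j)" if "i < i'" "j < ?nu i'" for i i' j
      using that le[of j i'] ss is_partitionD[OF t(1), of i i']
      by (auto simp: T' diagram_def semistandard_def)
    show "T' b = 0" if "b \<notin> diagram ?nu" for b using that by (simp add: T')
  qed
  then show "T' \<in> tableaux N ?nu"
    using iff le by (auto simp: tableaux_def T' diagram_def)
qed

lemma restrict_extend_tableau:
  assumes nu: "nu \<in> interlacing" and T: "T \<in> tableaux N (truncate N nu)"
  shows "restrict_tableau (extend_tableau (nu, T)) = (nu, T)"
proof -
  let ?T = "extend_tableau (nu, T)"
  have e: "restrict (\<lambda>i. row_count lam ?T i N) {0..<N} = nu"
  proof (rule ext)
    fix i
    show "restrict (\<lambda>i. row_count lam ?T i N) {0..<N} i = nu i"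
      using extend_tableau(2)[OF nu T, of i] PiE_arb[OF nu, of i] by (cases "i < N") simp_all
  qed
  have z: "T b = 0" if "b \<notin> diagram (truncate N nu)" for b
    using T that unfolding tableaux_def semistandard_def by blast
  have "(\<lambda>b. if b \<in> diagram (truncate N nu) then ?T b else 0) = T"
    by (rule ext) (simp add: extend_tableau_def z)
  then show ?thesis
    unfolding restrict_tableau_def Let_def e by simp
qed

lemma extend_restrict_tableau:
  assumes T: "T \<in> tableaux (Suc N) lam"
  shows "extend_tableau (restrict_tableau T) = T"
proof -
  obtain nu T' where r: "restrict_tableau T = (nu, T')" by fastforce
  note R = restrict_tableau[OF T r]
  note t = truncate_interlacing[OF R(1)]
  have T': "T' = (\<lambda>b. if b \<in> diagram (truncate N nu) then T b else 0)"
    using r by (auto simp: restrict_tableau_def Let_def)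
  have "extend_tableau (nu, T') (i, j) = T (i, j)" for i j
  proof (cases "j < lam i")
    case True
    then have "T (i, j) < Suc N" using T by (auto simp: tableaux_def diagram_def)
    then show ?thesis using R(3)[OF True] True by (auto simp: extend_tableau_def T' diagram_def)
  next
    case False
    then have "(i, j) \<notin> diagram lam" "(i, j) \<notin> diagram (truncate N nu)"
      using t(2)[of i] by (auto simp: diagram_def)
    then show ?thesis using T by (simp add: extend_tableau_def tableaux_def semistandard_def)
  qed
  then show ?thesis by (auto simp: r)
qed

lemma card_skew_interlacing:
  assumes nu: "nu \<in> interlacing"
  shows "card (diagram lam - diagram (truncate N nu)) = lam N + (\<Sum>i = 0..<N. lam i - nu i)"
proof -
  note t = truncate_interlacing[OF nu]
  have z: "i < Suc N" if "j < lam i" for i j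
    using is_partitionD[OF lam, of "Suc N" i] zero that by (cases "i < Suc N") auto
  have "diagram lam - diagram (truncate N nu) = (SIGMA i:{0..<Suc N}. {truncate N nu i..<lam i})"
    unfolding diagram_def by (auto dest: z)
  then have "card (diagram lam - diagram (truncate N nu)) = (\<Sum>i = 0..<Suc N. lam i - truncate N nu i)"
    by simp
  then show ?thesis by (simp add: truncate_def)
qed

text \<open>A tableau splits into its entries below \<open>N\<close> and a skew shape filled with
  \<open>N\<close>, each box of which contributes a factor \<open>x N\<close>.\<close>

lemma schur_poly_branch:
  "schur_poly (Suc N) x lam = (\<Sum>nu\<in>interlacing.
     x N ^ (lam N + (\<Sum>i = 0..<N. lam i - nu i)) * schur_poly N x (truncate N nu))"
proof -
  let ?w = "\<lambda>T. \<Prod>b\<in>diagram lam. x (T b)"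
  let ?w' = "\<lambda>nu T. x N ^ (lam N + (\<Sum>i = 0..<N. lam i - nu i)) * (\<Prod>b\<in>diagram (truncate N nu). x (T b))"
  have weight: "?w (extend_tableau (nu, T)) = ?w' nu T" if nu: "nu \<in> interlacing" for nu T
  proof -
    let ?D = "diagram (truncate N nu)"
    have sub: "?D \<subseteq> diagram lam"
      using truncate_interlacing(2)[OF nu] by (auto simp: diagram_def intro: less_le_trans)
    have "?w (extend_tableau (nu, T)) = (\<Prod>b\<in>diagram lam - ?D. x (extend_tableau (nu, T) b)) *
        (\<Prod>b\<in>?D. x (extend_tableau (nu, T) b))"
      by (rule prod.subset_diff[OF sub finite_diagram[OF lam]])
    also have "(\<Prod>b\<in>diagram lam - ?D. x (extend_tableau (nu, T) b)) = (\<Prod>b\<in>diagram lam - ?D. x N)"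
      by (rule prod.cong) (auto simp: extend_tableau_def)
    also have "(\<Prod>b\<in>?D. x (extend_tableau (nu, T) b)) = (\<Prod>b\<in>?D. x (T b))"
      by (rule prod.cong) (auto simp: extend_tableau_def)
    finally show ?thesis by (simp add: card_skew_interlacing[OF nu])
  qed
  have "schur_poly (Suc N) x lam =
    (\<Sum>(nu, T)\<in>(SIGMA nu:interlacing. tableaux N (truncate N nu)). ?w' nu T)"
    unfolding schur_poly_def
  proof (rule sum.reindex_bij_witness[where i = extend_tableau and j = restrict_tableau])
    fix T assume T: "T \<in> tableaux (Suc N) lam"
    obtain nu T' where r: "restrict_tableau T = (nu, T')" by fastforce
    note R = restrict_tableau[OF T r]
    show "extend_tableau (restrict_tableau T) = T" by (rule extend_restrict_tableau[OF T])
    then show "(case restrict_tableau T of (nu, T) \<Rightarrow> ?w' nu T) = ?w T"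
      using weight[OF R(1), of T'] by (simp add: r)
    show "restrict_tableau T \<in> (SIGMA nu:interlacing. tableaux N (truncate N nu))"
      using R by (simp add: r)
  qed (use restrict_extend_tableau extend_tableau(1) in auto)
  also have "\<dots> = (\<Sum>nu\<in>interlacing. \<Sum>T\<in>tableaux N (truncate N nu). ?w' nu T)"
    by (rule sum.Sigma[symmetric]) (auto intro: finite_PiE finite_tableaux truncate_interlacing)
  finally show ?thesis by (simp add: schur_poly_def sum_distrib_left)
qed

end

section \<open>The bialternant formula\<close>

text \<open>The empty partition has only the zero sequence as interlacing sequence, so the branching
  rule becomes the recursion of the Vandermonde product.\<close>

lemma alternant_staircase_Suc:
  "alternant (Suc N) x (shifted (Suc N) (\<lambda>_. 0)) =
     (\<Prod>j = 0..<N. x j - x N) * alternant N x (shifted N (\<lambda>_. 0))"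
proof -
  have "PiE {0..<N} (\<lambda>i. {0::nat..0}) = {restrict (\<lambda>_. 0) {0..<N}}"
    by (simp add: PiE_eq_singleton)
  moreover have "alternant N x (shifted N (restrict (\<lambda>_. 0) {0..<N})) = alternant N x (shifted N (\<lambda>_. 0))"
    by (rule alternant_cong) (simp add: shifted_def)
  ultimately show ?thesis
    by (subst alternant_branch) (auto simp: antimono_def)
qed

text \<open>Induction on the number of variables: both sides branch over the same interlacing
  sequences, and the extra product of differences is the one by which the staircase alternant
  grows.\<close>

theorem alternant_schur_poly:
  assumes "is_partition lam" "lam N = 0"
  shows "alternant N x (shifted N lam) = alternant N x (shifted N (\<lambda>_. 0)) * schur_poly N x lam"
  using assms
proof (induction N arbitrary: lam)
  case 0
  have "lam i = 0" for i using is_partitionD[OF 0(1), of 0 i] 0(2) by simp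
  then have "diagram lam = {}" by (simp add: diagram_def)
  moreover have "tableaux 0 lam = {\<lambda>_. 0}"
    using \<open>\<And>i. lam i = 0\<close> by (auto simp: tableaux_def semistandard_def diagram_def)
  ultimately show ?case by (simp add: alternant_def schur_poly_def)
next
  case (Suc N)
  have "alternant N x (shifted N nu) = alternant N x (shifted N (\<lambda>_. 0)) * schur_poly N x (truncate N nu)"
    if "nu \<in> PiE {0..<N} (\<lambda>i. {lam (Suc i)..lam i})" for nu
  proof -
    have "alternant N x (shifted N nu) = alternant N x (shifted N (truncate N nu))"
      by (rule alternant_cong) (simp add: shifted_def truncate_def)
    also have "\<dots> = alternant N x (shifted N (\<lambda>_. 0)) * schur_poly N x (truncate N nu)"
      by (rule Suc.IH, rule truncate_interlacing(1)[OF Suc.prems that]) (simp add: truncate_def)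
    finally show ?thesis .
  qed
  then have "(\<Sum>nu\<in>PiE {0..<N} (\<lambda>i. {lam (Suc i)..lam i}).
      x N ^ (lam N + (\<Sum>i = 0..<N. lam i - nu i)) * alternant N x (shifted N nu)) =
    alternant N x (shifted N (\<lambda>_. 0)) * schur_poly (Suc N) x lam"
    unfolding schur_poly_branch[OF Suc.prems] sum_distrib_left
    by (intro sum.cong refl) (simp only: mult.left_commute)
  moreover have "antimono lam" using Suc.prems(1) by (simp add: is_partition_def)
  ultimately show ?case
    by (simp only: alternant_staircase_Suc alternant_branch mult.assoc)
qed

subsection \<open>Border strips\<close>

text \<open>In contrast to \<open>shifted\<close>, no number of variables enters; beyond the last
  part the value is \<open>- int i\<close>.\<close>

definition beta :: "(nat \<Rightarrow> nat) \<Rightarrow> nat \<Rightarrow> int" where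
  "beta lam i = int (lam i) - int i"

lemma beta_strict: "is_partition lam \<Longrightarrow> i < j \<Longrightarrow> beta lam j < beta lam i"
  using is_partitionD[of lam i j] by (simp add: beta_def)

lemma beta_less_iff: "is_partition lam \<Longrightarrow> beta lam i < beta lam j \<longleftrightarrow> j < i"
  using beta_strict[of lam i j] beta_strict[of lam j i] by (metis less_asym nat_neq_iff)

lemma beta_eq_iff: "is_partition lam \<Longrightarrow> beta lam i = beta lam j \<longleftrightarrow> i = j"
  by (metis beta_less_iff less_irrefl nat_neq_iff)

text \<open>The sequence \<open>b i + int i\<close> is weakly decreasing and ends in 0, so it is
  nonnegative and \<open>nat\<close> does not cut off anything.\<close>

lemma partition_of_beta:
  assumes strict: "\<And>i. b (Suc i) < b i" and tail: "\<And>i. N \<le> i \<Longrightarrow> b i = - int i"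
  defines "lam \<equiv> \<lambda>i. nat (b i + int i)"
  shows "is_partition lam" "beta lam = b"
proof -
  have nonneg: "0 \<le> b i + int i" for i
  proof (cases "i \<le> N")
    case True
    then show ?thesis
    proof (induction rule: inc_induct)
      case base
      then show ?case by (simp add: tail)
    next
      case (step i)
      then show ?case using strict[of i] by simp
    qed
  qed (simp add: tail)
  have "beta lam i = b i" for i using nonneg[of i] by (simp add: beta_def lam_def)
  then show "beta lam = b" by (rule ext)
  show "is_partition lam"
  proof (rule is_partitionI[of _ N])
    show "lam (Suc i) \<le> lam i" for i
      using strict[of i] nonneg[of i] by (simp add: lam_def)
    show "lam i = 0" if "N \<le> i" for i using that by (simp add: lam_def tail)
  qed
qed

text \<open>
  In terms of the numbers \<open>beta al i\<close>, the one in row \<open>q\<close> grows and overtakes those in the rows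
  \<open>p, \<dots>, q - 1\<close>; all others keep their values.
\<close>

definition strip_rows :: "(nat \<Rightarrow> nat) \<Rightarrow> (nat \<Rightarrow> nat) \<Rightarrow> nat \<Rightarrow> nat \<Rightarrow> bool" where
  "strip_rows al be p q \<longleftrightarrow> p \<le> q \<and> (\<forall>i. i < p \<or> q < i \<longrightarrow> be i = al i) \<and>
     (\<forall>i. p \<le> i \<longrightarrow> i < q \<longrightarrow> be (Suc i) = Suc (al i)) \<and> al q < be q"

section \<open>The geometry of strips described by rows\<close>

lemma skew_iff: "(i, j) \<in> skew be al \<longleftrightarrow> al i \<le> j \<and> j < be i"
  by (auto simp: skew_def diagram_def)

lemma strip_rows_less:
  assumes "strip_rows al be p q" "is_partition be" "p \<le> i" "i \<le> q"
  shows "al i < be i"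
proof (cases "i = q")
  case False
  then have "be (Suc i) = Suc (al i)" using assms by (simp add: strip_rows_def)
  then show ?thesis using is_partitionD[OF assms(2), of i "Suc i"] by simp
qed (use assms in \<open>simp add: strip_rows_def\<close>)

lemma strip_rows_skew:
  assumes "strip_rows al be p q" "is_partition be"
  shows "skew be al = (SIGMA i:{p..q}. {al i..<be i})"
proof -
  have "p \<le> i \<and> i \<le> q" if "al i \<le> j" "j < be i" for i j
  proof (rule ccontr)
    assume "\<not> ?thesis"
    then have "be i = al i" using assms(1) by (auto simp: strip_rows_def)
    then show False using that by simp
  qed
  then show ?thesis by (auto simp: skew_iff)
qed

text \<open>The assumption says \<open>beta be (Suc i) = beta al i\<close>, so the sum of the
  differences telescopes.\<close>

lemma sum_overlapping_rows:
  assumes "p \<le> q" "\<And>i. p \<le> i \<Longrightarrow> i < q \<Longrightarrow> be (Suc i) = Suc (al i)"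
  shows "(\<Sum>i = p..q. int (be i) - int (al i)) = beta be p - beta al q"
  using assms
proof (induction rule: dec_induct)
  case base
  then show ?case by (simp add: beta_def)
next
  case (step q)
  then show ?case by (simp add: beta_def)
qed

lemma strip_rows_card:
  assumes "strip_rows al be p q" "is_partition be"
  shows "int (card (skew be al)) = beta be p - beta al q"
proof -
  have "int (card (skew be al)) = (\<Sum>i = p..q. int (be i - al i))"
    unfolding strip_rows_skew[OF assms] by simp
  also have "\<dots> = (\<Sum>i = p..q. int (be i) - int (al i))"
    using strip_rows_less[OF assms] by (intro sum.cong) (auto simp: of_nat_diff less_imp_le)
  also have "\<dots> = beta be p - beta al q"
    using assms(1) by (intro sum_overlapping_rows) (auto simp: strip_rows_def)
  finally show ?thesis .
qed

lemma strip_rows_height: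
  assumes "strip_rows al be p q" "is_partition be"
  shows "strip_height (skew be al) = q - p"
proof -
  have "fst ` skew be al = {p..q}"
    unfolding strip_rows_skew[OF assms] using strip_rows_less[OF assms] by (force simp: image_iff)
  moreover have "p \<le> q" using assms(1) by (simp add: strip_rows_def)
  ultimately show ?thesis by (simp add: strip_height_def)
qed

lemma strip_rows_starting_box:
  assumes "strip_rows al be p q" "is_partition be"
  shows "starting_box (skew be al) = (p, be p - 1)"
  unfolding starting_box_def
proof (rule the_equality)
  have pq: "p \<le> q" using assms(1) by (simp add: strip_rows_def)
  let ?P = "\<lambda>b. b \<in> skew be al \<and> (\<forall>c\<in>skew be al. fst b \<le> fst c \<and> snd c \<le> snd b)"
  have "j \<le> be p - 1" if "(i, j) \<in> skew be al" for i j
  proof -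
    have "p \<le> i" "j < be i" using that by (auto simp: strip_rows_skew[OF assms])
    then show ?thesis using is_partitionD[OF assms(2), of p i] by simp
  qed
  then show P: "?P (p, be p - 1)"
    using strip_rows_less[OF assms, of p] pq by (auto simp: strip_rows_skew[OF assms])
  show "b = (p, be p - 1)" if "?P b" for b
    using that P by (metis (no_types, lifting) dual_order.antisym prod.collapse fst_conv snd_conv)
qed

text \<open>Consecutive rows of the strip share exactly the column \<open>al i\<close>: enough for
  connectedness, too little for a square. Connectedness is shown by walking from each box to the
  starting box.\<close>

lemma border_strip_of_rows:
  assumes "strip_rows al be p q" "is_partition al" "is_partition be" "beta be p = beta al q + int n"
  shows "border_strip n (skew be al)"
proof -
  let ?D = "skew be al"
  let ?R = "{(x, y). x \<in> ?D \<and> y \<in> ?D \<and> adjacent x y}"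
  note D = strip_rows_skew[OF assms(1,3)] and less = strip_rows_less[OF assms(1,3)]
  have sym: "sym (?R\<^sup>*)" by (rule sym_rtrancl) (auto simp: sym_def)
  have row: "((i, j), (i, be i - 1)) \<in> ?R\<^sup>*" if "j + d = be i - 1" "(i, j) \<in> ?D" for i j d
    using that
  proof (induction d arbitrary: j)
    case (Suc d)
    then have "(i, Suc j) \<in> ?D" by (auto simp: skew_iff)
    then have "((i, Suc j), (i, be i - 1)) \<in> ?R\<^sup>*"
      using Suc.prems(1) by (intro Suc.IH) simp_all
    moreover have "((i, j), (i, Suc j)) \<in> ?R" using \<open>(i, Suc j) \<in> ?D\<close> Suc.prems(2) by simp
    ultimately show ?case by (rule converse_rtrancl_into_rtrancl[rotated])
  qed simp
  have up: "((i, be i - 1), (p, be p - 1)) \<in> ?R\<^sup>*" if "p \<le> i" "i \<le> q" for i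
    using that
  proof (induction rule: dec_induct)
    case (step i)
    then have e: "be (Suc i) = Suc (al i)" using assms(1) by (simp add: strip_rows_def)
    have D2: "(Suc i, al i) \<in> ?D" "(i, al i) \<in> ?D"
      using less[of "Suc i"] less[of i] step e by (auto simp: skew_iff)
    then have "((i, al i), (i, be i - 1)) \<in> ?R\<^sup>*"
      using less[of i] step by (intro row[of _ "be i - 1 - al i"]) auto
    moreover have "((i, be i - 1), (p, be p - 1)) \<in> ?R\<^sup>*"
      using step by simp
    ultimately have "((i, al i), (p, be p - 1)) \<in> ?R\<^sup>*" by (rule rtrancl_trans)
    \<comment> \<open>The last box of row \<open>Suc i\<close> lies directly below the first box of
      row \<open>i\<close>.\<close>
    moreover have "((Suc i, be (Suc i) - 1), (i, al i)) \<in> ?R"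
      using D2 by (simp add: e)
    ultimately show ?case by (rule converse_rtrancl_into_rtrancl[rotated])
  qed simp
  have root: "(b, (p, be p - 1)) \<in> ?R\<^sup>*" if b: "b \<in> ?D" for b
  proof (cases b)
    case (Pair i j)
    then have ij: "p \<le> i" "i \<le> q" "j < be i" using b by (auto simp: D)
    then have "((i, j), (i, be i - 1)) \<in> ?R\<^sup>*"
      using b Pair by (intro row[of _ "be i - 1 - j"]) auto
    then show ?thesis using up[OF ij(1,2)] Pair by simp
  qed
  have "connected_boxes ?D"
    unfolding connected_boxes_def
  proof (intro ballI)
    fix b c assume "b \<in> ?D" "c \<in> ?D"
    then show "(b, c) \<in> ?R\<^sup>*"
      using rtrancl_trans[OF root[of b] symD[OF sym root[of c]]] by simp
  qed
  moreover have "card ?D = n" using strip_rows_card[OF assms(1,3)] assms(4) by simp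
  moreover have "finite ?D" by (simp add: D)
  moreover have "\<not> {(i, j), (i, Suc j), (Suc i, j), (Suc i, Suc j)} \<subseteq> ?D" for i j
  proof
    assume "{(i, j), (i, Suc j), (Suc i, j), (Suc i, Suc j)} \<subseteq> ?D"
    then have "(i, j) \<in> ?D" "(Suc i, Suc j) \<in> ?D" by auto
    then have "p \<le> i" "Suc i \<le> q" "al i \<le> j" "Suc j < be (Suc i)" by (auto simp: D)
    then show False using assms(1) by (simp add: strip_rows_def)
  qed
  ultimately show ?thesis by (simp add: border_strip_def)
qed

text \<open>The absence of squares bounds the overlap of consecutive rows by one column from above,
  and connectedness bounds it from below.\<close>

lemma border_strip_rows:
  assumes al: "is_partition al" and be: "is_partition be" and le: "al \<le> be" and n: "n > 0"
    and strip: "border_strip n (skew be al)"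
  obtains p q where "strip_rows al be p q" "beta be p = beta al q + int n"
proof -
  let ?D = "skew be al"
  let ?R = "{(x, y). x \<in> ?D \<and> y \<in> ?D \<and> adjacent x y}"
  define I where "I = {i. al i < be i}"
  have ne: "?D \<noteq> {}" using strip n by (auto simp: border_strip_def)
  have fin: "finite I"
  proof (rule finite_subset)
    show "I \<subseteq> {i. be i \<noteq> 0}" by (auto simp: I_def)
    show "finite {i. be i \<noteq> 0}" using be by (simp add: is_partition_def)
  qed
  from ne obtain i j where "(i, j) \<in> ?D" by fastforce
  then have "i \<in> I" by (auto simp: I_def skew_iff)
  then have I: "Min I \<in> I" "Max I \<in> I" "Min I \<le> Max I"
    using fin by (auto intro: Min_in Max_in order_trans[OF Min_le Max_ge])
  define p q where "p = Min I" and "q = Max I"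
  have out: "be i = al i" if "i < p \<or> q < i" for i
  proof -
    have "p \<le> i \<and> i \<le> q" if "i \<in> I" using fin that by (simp add: p_def q_def)
    then have "i \<notin> I" using that by auto
    then show ?thesis using le_funD[OF le, of i] by (simp add: I_def)
  qed
  have no_square: "be (Suc i) \<le> Suc (al i)" for i
  proof (rule ccontr)
    assume "\<not> ?thesis"
    then have "{(i, al i), (i, Suc (al i)), (Suc i, al i), (Suc i, Suc (al i))} \<subseteq> ?D"
      using is_partitionD[OF al, of i "Suc i"] is_partitionD[OF be, of i "Suc i"]
      by (auto simp: skew_iff)
    then show False using strip unfolding border_strip_def by blast
  qed
  have overlap: "Suc (al i) \<le> be (Suc i)" if i: "p \<le> i" "i < q" for i
  proof (rule ccontr)
    assume gap: "\<not> ?thesis"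
    have "((p, al p), (q, al q)) \<in> ?R\<^sup>*"
      using strip I unfolding border_strip_def connected_boxes_def
      by (auto simp: skew_iff I_def p_def q_def)
    \<comment> \<open>If rows \<open>i\<close> and \<open>Suc i\<close> share no column, a path that
      starts in row \<open>p\<close> never gets below row \<open>i\<close>.\<close>
    then have "fst (q, al q) \<le> i"
    proof (induction rule: rtrancl_induct)
      case (step y z)
      then have "adjacent y z" "y \<in> ?D" "z \<in> ?D" "fst y \<le> i" by auto
      then show ?case using gap by (cases y, cases z, cases "fst y = i") (auto simp: skew_iff)
    qed (use i in simp)
    then show False using i by simp
  qed
  have rows: "strip_rows al be p q"
    unfolding strip_rows_def
  proof (intro conjI allI impI)
    show "p \<le> q" using I(3) by (simp add: p_def q_def)
    show "al q < be q" using I(2) by (simp add: I_def q_def)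
    show "be i = al i" if "i < p \<or> q < i" for i by (rule out[OF that])
    show "be (Suc i) = Suc (al i)" if "p \<le> i" "i < q" for i
      by (rule le_antisym[OF no_square overlap[OF that]])
  qed
  have "beta be p = beta al q + int n"
    using strip_rows_card[OF rows be] strip by (simp add: border_strip_def)
  with rows show ?thesis by (rule that)
qed

text \<open>This cycle describes how the rows are renumbered by a strip: row \<open>q\<close> jumps
  to \<open>p\<close>, and the rows it overtakes move down by one. The exponent of its sign is the
  height of the strip.\<close>

lemma cycle_exists:
  assumes "p \<le> q"
  obtains c where "c permutes {p..q::nat}" "sign c = (- 1) ^ (q - p)" "c q = p"
    "\<And>i. p \<le> i \<Longrightarrow> i < q \<Longrightarrow> c i = Suc i"
proof -
  have "\<exists>c. c permutes {p..q} \<and> sign c = (- 1) ^ (q - p) \<and> c q = p \<and> (\<forall>i. p \<le> i \<longrightarrow> i < q \<longrightarrow> c i = Suc i)"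
    using assms
  proof (induction rule: dec_induct)
    case base
    show ?case by (rule exI[of _ id]) (auto simp: permutes_id)
  next
    case (step q)
    then obtain c where c: "c permutes {p..q}" "sign c = (- 1) ^ (q - p)" "c q = p"
      "\<And>i. p \<le> i \<Longrightarrow> i < q \<Longrightarrow> c i = Suc i" by blast
    let ?t = "Transposition.transpose q (Suc q)"
    have t: "?t permutes {p..Suc q}" using step by (intro permutes_swap_id) auto
    have c': "c permutes {p..Suc q}" by (rule permutes_subset[OF c(1)]) auto
    have fx: "c (Suc q) = Suc q" using c(1) by (rule permutes_not_in) simp
    have "sign (c \<circ> ?t) = sign c * sign ?t"
      using c(1) by (intro sign_compose) (auto intro: permutation_permutes[THEN iffD2] permutation_swap_id)
    then have "sign (c \<circ> ?t) = (- 1) ^ (Suc q - p)"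
      using step by (simp add: c(2) sign_swap_id Suc_diff_le)
    moreover have "(c \<circ> ?t) permutes {p..Suc q}" by (rule permutes_compose[OF t c'])
    moreover have "(c \<circ> ?t) i = Suc i" if "p \<le> i" "i < Suc q" for i
      using that c(4)[of i] fx by (cases "i = q") auto
    moreover have "(c \<circ> ?t) (Suc q) = p" using c(3) by simp
    ultimately show ?case by blast
  qed
  then show ?thesis using that by blast
qed

subsection \<open>Chains of border strips\<close>

text \<open>The numbers \<open>beta\<close> strictly decrease with the row, so their set determines
  the sequence.\<close>

lemma partition_eqI_beta_image:
  assumes "is_partition lam" "is_partition mu"
    and "\<And>i. N \<le> i \<Longrightarrow> lam i = 0" "\<And>i. N \<le> i \<Longrightarrow> mu i = 0"
    and "beta lam ` {0..<N} = beta mu ` {0..<N}"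
  shows "lam = mu"
proof
  fix i
  have "\<forall>i<N. beta lam i = beta mu i"
  proof (intro allI impI)
    fix i assume "i < N"
    then show "beta lam i = beta mu i"
    proof (induction i rule: less_induct)
      case (less i)
      obtain j where j: "j < N" "beta lam i = beta mu j"
        using assms(5) less.prems by (metis atLeastLessThan_iff imageE image_eqI zero_le)
      obtain j' where j': "j' < N" "beta mu i = beta lam j'"
        using assms(5) less.prems by (metis atLeastLessThan_iff imageE image_eqI zero_le)
      have "i \<le> j"
      proof (rule ccontr)
        assume "\<not> i \<le> j"
        then show False using less.IH[of j] j less.prems beta_eq_iff[OF assms(1), of i j] by simp
      qed
      moreover have "i \<le> j'"
      proof (rule ccontr)
        assume "\<not> i \<le> j'"
        then show False using less.IH[of j'] j' less.prems beta_eq_iff[OF assms(2), of i j'] by simp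
      qed
      ultimately show ?case
        using j(2) j'(2) beta_less_iff[OF assms(1), of i j'] beta_less_iff[OF assms(2), of j i]
          beta_less_iff[OF assms(1), of j' i] beta_less_iff[OF assms(2), of i j]
        by linarith
    qed
  qed
  then show "lam i = mu i" using assms(3,4)[of i] by (cases "i < N") (auto simp: beta_def)
qed

section \<open>Chains as sequences of moves of beta numbers\<close>

text \<open>The strip with index \<open>t\<close> occupies the rows \<open>p t\<close> to
  \<open>q t\<close>. The conditions on starting boxes in \<open>strip_chain\<close> are expressed
  by the increase of the targets; the two notions are compared below.\<close>

definition move_chain ::
  "nat \<Rightarrow> nat \<Rightarrow> nat \<Rightarrow> (nat \<Rightarrow> nat) \<Rightarrow> (nat \<Rightarrow> nat) \<Rightarrow> (nat \<Rightarrow> nat \<Rightarrow> nat) \<Rightarrow> (nat \<Rightarrow> nat) \<Rightarrow> (nat \<Rightarrow> nat) \<Rightarrow> bool" where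
  "move_chain n N k lam mu \<alpha> p q \<longleftrightarrow>
     \<alpha> 0 = mu \<and> \<alpha> k = lam \<and> (\<forall>t\<le>k. is_partition (\<alpha> t)) \<and>
     (\<forall>t<k. strip_rows (\<alpha> t) (\<alpha> (Suc t)) (p t) (q t) \<and> q t < N \<and>
        beta (\<alpha> (Suc t)) (p t) = beta (\<alpha> t) (q t) + int n) \<and>
     (\<forall>s t. s < t \<longrightarrow> t < k \<longrightarrow> beta (\<alpha> (Suc s)) (p s) < beta (\<alpha> (Suc t)) (p t))"

text \<open>
  The permutation records where each element of \<open>beta mu\<close> has moved to. Because the targets increase,
  an element can only move into the gap below the next original element of its residue class.
\<close>

lemma move_chain_permutation:
  assumes ch: "move_chain n N k lam mu \<alpha> p q" and n: "n > 0" and t: "t \<le> k"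
  shows "\<exists>\<tau>. \<tau> permutes {0..<N} \<and> sign \<tau> = (\<Prod>i<t. (- 1) ^ (q i - p i)) \<and>
    (\<forall>j<N. beta mu j \<le> beta (\<alpha> t) (\<tau> j) \<and> int n dvd beta (\<alpha> t) (\<tau> j) - beta mu j) \<and>
    (\<forall>j<N. \<forall>j'<N. int n dvd beta (\<alpha> t) (\<tau> j) - beta (\<alpha> t) (\<tau> j') \<longrightarrow>
       beta (\<alpha> t) (\<tau> j') < beta (\<alpha> t) (\<tau> j) \<longrightarrow> beta (\<alpha> t) (\<tau> j') < beta mu j) \<and>
    (\<forall>j<N. (\<forall>s<t. beta (\<alpha> (Suc s)) (p s) < beta (\<alpha> t) (\<tau> j)) \<longrightarrow> beta (\<alpha> t) (\<tau> j) = beta mu j)"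
  using t
proof (induction t)
  case 0
  then show ?case using ch by (intro exI[of _ id] conjI, intro permutes_id) (simp_all add: move_chain_def)
next
  case (Suc t)
  let ?a = "beta (\<alpha> t)" and ?b = "beta (\<alpha> (Suc t))" and ?m = "beta mu"
  have tk: "t < k" using Suc.prems by simp
  obtain \<tau> where \<tau>: "\<tau> permutes {0..<N}" and sgn: "sign \<tau> = (\<Prod>i<t. (- 1) ^ (q i - p i))"
    and up: "\<And>j. j < N \<Longrightarrow> ?m j \<le> ?a (\<tau> j)" "\<And>j. j < N \<Longrightarrow> int n dvd ?a (\<tau> j) - ?m j"
    and gap: "\<And>j j'. j < N \<Longrightarrow> j' < N \<Longrightarrow> int n dvd ?a (\<tau> j) - ?a (\<tau> j') \<Longrightarrow> ?a (\<tau> j') < ?a (\<tau> j) \<Longrightarrow> ?a (\<tau> j') < ?m j"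
    and fixed: "\<And>j. j < N \<Longrightarrow> (\<And>s. s < t \<Longrightarrow> beta (\<alpha> (Suc s)) (p s) < ?a (\<tau> j)) \<Longrightarrow> ?a (\<tau> j) = ?m j"
    using Suc.IH tk by auto
  have part: "is_partition (\<alpha> t)" using ch tk by (simp add: move_chain_def)
  have rows: "strip_rows (\<alpha> t) (\<alpha> (Suc t)) (p t) (q t)" and qN: "q t < N"
    and target: "?b (p t) = ?a (q t) + int n"
    and earlier: "\<And>s. s < t \<Longrightarrow> beta (\<alpha> (Suc s)) (p s) < ?b (p t)"
    using ch tk by (auto simp: move_chain_def)
  have pq: "p t \<le> q t" using rows by (simp add: strip_rows_def)
  obtain c where c: "c permutes {p t..q t}" "sign c = (- 1) ^ (q t - p t)" "c (q t) = p t"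
    "\<And>i. p t \<le> i \<Longrightarrow> i < q t \<Longrightarrow> c i = Suc i"
    using cycle_exists[OF pq] by blast
  \<comment> \<open>Followed along the cycle, every number keeps its value except the one raised by
    \<open>n\<close>.\<close>
  have bc: "?b (c i) = ?a i + (if i = q t then int n else 0)" for i
  proof -
    consider "i < p t \<or> q t < i" | "i = q t" | "p t \<le> i" "i < q t" by linarith
    then show ?thesis
    proof cases
      case 1
      then have "c i = i" using c(1) by (auto intro: permutes_not_in)
      then show ?thesis using 1 rows pq by (auto simp: beta_def strip_rows_def)
    next
      case 3
      then show ?thesis using c(4) rows by (simp add: beta_def strip_rows_def)
    qed (use c target in simp)
  qed
  let ?\<tau> = "c \<circ> \<tau>"
  have inj: "\<tau> j = \<tau> j' \<longleftrightarrow> j = j'" for j j' using permutes_inj[OF \<tau>] by (auto dest: injD)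
  have c': "c permutes {0..<N}" by (rule permutes_subset[OF c(1)]) (use qN in auto)
  have "sign ?\<tau> = sign c * sign \<tau>"
    by (rule sign_compose) (use c' \<tau> in \<open>auto simp: permutation_permutes\<close>)
  then have s: "sign ?\<tau> = (\<Prod>i<Suc t. (- 1) ^ (q i - p i))" by (simp add: sgn c(2) mult.commute)
  have fixed': "?b (?\<tau> j) = ?m j" if j: "j < N" and b: "\<forall>s<Suc t. beta (\<alpha> (Suc s)) (p s) < ?b (?\<tau> j)" for j
  proof -
    have "\<tau> j \<noteq> q t" using b c(3) by auto
    then have "?b (?\<tau> j) = ?a (\<tau> j)" by (simp add: bc)
    then show ?thesis using fixed[OF j] b by simp
  qed
  have gap': "?b (?\<tau> j') < ?m j"
    if j: "j < N" "j' < N" and dvd: "int n dvd ?b (?\<tau> j) - ?b (?\<tau> j')" and less: "?b (?\<tau> j') < ?b (?\<tau> j)" for j j'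
  proof (cases "\<tau> j' = q t")
    \<comment> \<open>The lower element has just moved to the largest target so far. The upper one
      lies above all targets and therefore still has its original value.\<close>
    case True
    then have "\<tau> j \<noteq> q t" using less by auto
    moreover have "?b (p t) < ?b (?\<tau> j)" using less True c(3) by simp
    then have "?b (?\<tau> j) = ?m j"
      using fixed'[OF j(1)] earlier by (metis less_Suc_eq less_trans)
    ultimately show ?thesis using less by simp
  next
    case False
    then have b': "?b (?\<tau> j') = ?a (\<tau> j')" by (simp add: bc)
    show ?thesis
    proof (cases "\<tau> j = q t")
      \<comment> \<open>The upper element has just been raised by \<open>n\<close>. Congruence puts
        the lower one at or below its previous value, and distinctness strictly below, so the old
        gap applies.\<close>
      case True
      then have b: "?b (?\<tau> j) = ?a (\<tau> j) + int n" by (simp add: bc)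
      have pos: "0 < ?a (\<tau> j) + int n - ?a (\<tau> j')" using less b b' by simp
      have dvd': "int n dvd ?a (\<tau> j) + int n - ?a (\<tau> j')" using dvd b b' by simp
      have "int n \<le> ?a (\<tau> j) + int n - ?a (\<tau> j')" by (rule zdvd_imp_le[OF dvd' pos])
      moreover have "?a (\<tau> j) \<noteq> ?a (\<tau> j')" using True False by (simp add: beta_eq_iff[OF part])
      moreover have "int n dvd ?a (\<tau> j) - ?a (\<tau> j')"
      proof -
        have "?a (\<tau> j) + int n - ?a (\<tau> j') = (?a (\<tau> j) - ?a (\<tau> j')) + int n" by simp
        then show ?thesis using dvd' by (metis dvd_add_left_iff dvd_refl)
      qed
      ultimately show ?thesis using gap[OF j] b' by simp
    next
      case False
      then have "?b (?\<tau> j) = ?a (\<tau> j)" by (simp add: bc)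
      then show ?thesis using gap[OF j] dvd less b' by simp
    qed
  qed
  have up': "?m j \<le> ?b (?\<tau> j)" "int n dvd ?b (?\<tau> j) - ?m j" if "j < N" for j
  proof -
    have "?a (\<tau> j) + int n - ?m j = (?a (\<tau> j) - ?m j) + int n" by simp
    then have "int n dvd ?a (\<tau> j) + int n - ?m j" using up(2)[OF that] by (metis dvd_add dvd_refl)
    then show "?m j \<le> ?b (?\<tau> j)" "int n dvd ?b (?\<tau> j) - ?m j" using up[OF that] by (auto simp: bc)
  qed
  have "?\<tau> permutes {0..<N}" by (rule permutes_compose[OF \<tau> c'])
  then show ?case using s up' gap' fixed' by (intro exI[of _ ?\<tau>] conjI allI impI) blast+
qed

section \<open>Interlacing matchings\<close>

text \<open>Within a residue class \<open>x1 > x2 > ...\<close> this means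
  \<open>x1 >= f x1 > x2 >= f x2 > ...\<close>. The map acts on values instead of rows, so it
  survives the renumbering of rows when a number is moved.\<close>

definition interlaced :: "nat \<Rightarrow> nat \<Rightarrow> (nat \<Rightarrow> nat) \<Rightarrow> (nat \<Rightarrow> nat) \<Rightarrow> (int \<Rightarrow> int) \<Rightarrow> bool" where
  "interlaced n N lam mu f \<longleftrightarrow> (\<forall>x\<in>beta lam ` {0..<N}.
     f x \<in> beta mu ` {0..<N} \<and> f x \<le> x \<and> int n dvd x - f x \<and>
     (\<forall>y\<in>beta lam ` {0..<N}. y < x \<longrightarrow> int n dvd x - y \<longrightarrow> y < f x))"

text \<open>Elements with equal images are congruent, and interlacing would put the smaller one
  strictly below its own image. Surjectivity follows by counting.\<close>

lemma interlaced_bij: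
  assumes lam: "is_partition lam" and mu: "is_partition mu" and f: "interlaced n N lam mu f"
  shows "bij_betw f (beta lam ` {0..<N}) (beta mu ` {0..<N})"
proof -
  let ?A = "beta lam ` {0..<N}" and ?M = "beta mu ` {0..<N}"
  have F: "f x \<in> ?M" "f x \<le> x" "int n dvd x - f x"
    "\<And>y. y \<in> ?A \<Longrightarrow> y < x \<Longrightarrow> int n dvd x - y \<Longrightarrow> y < f x" if "x \<in> ?A" for x
    using f that unfolding interlaced_def by blast+
  have inj: "inj_on f ?A"
  proof (rule linorder_inj_onI)
    fix y x assume yx: "y < x" "y \<in> ?A" "x \<in> ?A"
    show "f y \<noteq> f x"
    proof
      assume e: "f y = f x"
      have "int n dvd (x - f x) - (y - f y)" by (rule dvd_diff[OF F(3)[OF yx(3)] F(3)[OF yx(2)]])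
      then have "y < f x" using F(4)[OF yx(3,2,1)] e by simp
      then show False using F(2)[OF yx(2)] e by simp
    qed
  qed auto
  have "card ?A = N" "card ?M = N"
    using beta_eq_iff lam mu by (auto simp: card_image inj_on_def)
  moreover have "f ` ?A \<subseteq> ?M" using F(1) by blast
  ultimately have "f ` ?A = ?M"
    using card_image[OF inj] by (intro card_subset_eq) auto
  then show ?thesis using inj by (simp add: bij_betw_def)
qed

text \<open>The chain is built from its end: the largest element that has moved is moved back by \<open>n\<close>.\<close>

lemma move_chain_exists:
  assumes "is_partition lam" "is_partition mu" "n > 0"
    and "\<And>i. N \<le> i \<Longrightarrow> lam i = 0" "\<And>i. N \<le> i \<Longrightarrow> mu i = 0"
    and "interlaced n N lam mu f"
    and "\<Sum>(beta lam ` {0..<N}) = \<Sum>(beta mu ` {0..<N}) + int n * int k"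
  shows "\<exists>\<alpha> p q. move_chain n N k lam mu \<alpha> p q \<and>
    (\<forall>t<k. \<exists>x\<in>beta lam ` {0..<N}. f x < x \<and> beta (\<alpha> (Suc t)) (p t) \<le> x)"
  using assms(1,4,6,7)
proof (induction k arbitrary: lam f)
  case 0
  let ?A = "beta lam ` {0..<N}" and ?M = "beta mu ` {0..<N}"
  have bij: "bij_betw f ?A ?M" by (rule interlaced_bij[OF 0(1) assms(2) 0(3)])
  have le: "f x \<le> x" if "x \<in> ?A" for x using 0(3) that unfolding interlaced_def by blast
  \<comment> \<open>The distances moved are nonnegative with sum 0, so nothing has moved.\<close>
  have "(\<Sum>x\<in>?A. x - f x) = \<Sum>?A - \<Sum>?M"
    using sum.reindex_bij_betw[OF bij, of "\<lambda>x. x"] by (simp add: sum_subtractf)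
  then have "(\<Sum>x\<in>?A. x - f x) = 0" using 0(4) by simp
  then have "f x = x" if "x \<in> ?A" for x
    using that le by (subst (asm) sum_nonneg_eq_0_iff) auto
  then have "f ` ?A = ?A" by simp
  then have "?A = ?M" using bij by (simp add: bij_betw_def)
  then have "lam = mu" by (intro partition_eqI_beta_image[of _ _ N] 0 assms)
  then show ?case using 0(1) by (intro exI[of _ "\<lambda>_. lam"]) (simp add: move_chain_def)
next
  case (Suc k)
  let ?l = "beta lam" and ?A = "beta lam ` {0..<N}" and ?M = "beta mu ` {0..<N}"
  note lam = Suc.prems(1)
  have F: "f x \<in> ?M" "f x \<le> x" "int n dvd x - f x"
    "\<And>y. y \<in> ?A \<Longrightarrow> y < x \<Longrightarrow> int n dvd x - y \<Longrightarrow> y < f x" if "x \<in> ?A" for x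
    using Suc.prems(3) that unfolding interlaced_def by blast+
  have bij: "bij_betw f ?A ?M" by (rule interlaced_bij[OF lam assms(2) Suc.prems(3)])
  define V where "V = {x\<in>?A. f x < x}"
  have "V \<noteq> {}"
  proof
    assume "V = {}"
    then have "f x = x" if "x \<in> ?A" for x using F(2)[OF that] that unfolding V_def by force
    then have "f ` ?A = ?A" by simp
    then have "?A = ?M" using bij by (simp add: bij_betw_def)
    then show False using Suc.prems(4) assms(3) by simp
  qed
  moreover have "finite V" by (simp add: V_def)
  moreover define B where "B = Max V"
  ultimately have BV: "B \<in> V" and max: "\<And>x. x \<in> V \<Longrightarrow> x \<le> B" by auto
  then have B: "B \<in> ?A" "f B < B" by (auto simp: V_def)
  define C where "C = B - int n"
  have fC: "f B \<le> C" using zdvd_imp_le[of "int n" "B - f B"] F(3)[OF B(1)] B(2) by (simp add: C_def)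
  have CB: "C < B" "int n dvd B - C" using assms(3) by (auto simp: C_def)
  \<comment> \<open>An element of \<open>?A\<close> at \<open>C\<close> would have to lie below
    \<open>f B\<close> by interlacing, but \<open>f B\<close> is at most \<open>C\<close>.\<close>
  have CA: "C \<notin> ?A" using F(4)[OF B(1) _ CB] fC by auto
  obtain p where p: "p < N" "?l p = B" using B(1) by auto
  \<comment> \<open>The value \<open>C\<close> will be placed in row \<open>q\<close>, the last one
    whose number exceeds \<open>C\<close>; the numbers of the rows after \<open>p\<close> up to
    \<open>q\<close> move up by one row.\<close>
  define Q where "Q = {i. i < N \<and> C < ?l i}"
  define q where "q = Max Q"
  have Q: "finite Q" "p \<in> Q" using p CB by (auto simp: Q_def)
  then have "q \<in> Q" unfolding q_def by (intro Max_in) auto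
  then have q: "q < N" "C < ?l q" by (auto simp: Q_def)
  have pq: "p \<le> q" unfolding q_def using Q by simp
  have above: "?l i < C" if "q < i" for i
  proof (cases "i < N")
    case True
    then have "i \<notin> Q" using Max_ge[OF Q(1), of i] that by (auto simp: q_def)
    then have "?l i \<le> C" using True by (simp add: Q_def)
    moreover have "?l i \<noteq> C" using CA True by auto
    ultimately show ?thesis by simp
  next
    \<comment> \<open>From row \<open>N\<close> on the numbers are \<open>- int i\<close>, below
      those of the first \<open>N\<close> rows of \<open>mu\<close> and hence below
      \<open>f B\<close>.\<close>
    case False
    obtain j where "j < N" "f B = beta mu j" using F(1)[OF B(1)] by auto
    then show ?thesis using False fC Suc.prems(2)[of i] by (simp add: beta_def)
  qed
  define b where "b i = (if i < p \<or> q < i then ?l i else if i < q then ?l (Suc i) else C)" for i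
  have strict: "b (Suc i) < b i" for i
    using beta_strict[OF lam, of i "Suc i"] beta_strict[OF lam, of i "Suc (Suc i)"]
      beta_strict[OF lam, of "Suc i" "Suc (Suc i)"] above[of "Suc i"] q(2) pq p(2) CB(1)
      beta_strict[OF lam, of i q]
    by (cases "Suc i = q"; cases "i = q"; cases "Suc i = p") (auto simp: b_def)
  have tail: "b i = - int i" if "N \<le> i" for i
    using that q(1) Suc.prems(2) by (simp add: b_def beta_def)
  define lam' where "lam' = (\<lambda>i. nat (b i + int i))"
  have lam': "is_partition lam'" and b: "beta lam' = b"
    using partition_of_beta[of b N, OF strict tail] by (simp_all add: lam'_def)
  have zero': "lam' i = 0" if "N \<le> i" for i using tail[OF that] by (simp add: lam'_def)
  let ?A' = "beta lam' ` {0..<N}"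
  have A': "?A' = insert C (?A - {B})"
  proof (intro equalityI subsetI)
    fix x assume "x \<in> ?A'"
    then obtain i where i: "i < N" "x = b i" by (auto simp: b)
    have "?l i \<noteq> B" if "i \<noteq> p" for i using that p(2) beta_eq_iff[OF lam, of i p] by auto
    then show "x \<in> insert C (?A - {B})" using i q(1) pq by (auto simp: b_def)
  next
    fix x assume "x \<in> insert C (?A - {B})"
    then consider "x = C" | "x \<in> ?A" "x \<noteq> B" by blast
    then show "x \<in> ?A'"
    proof cases
      case 1
      then have "x = b q" using pq by (simp add: b_def)
      then show ?thesis using q(1) by (simp add: b)
    next
      case 2
      from 2(1) obtain i where i: "i < N" "x = ?l i" by auto
      then have "i \<noteq> p" using 2(2) p(2) by auto
      show ?thesis
      proof (cases "i < p \<or> q < i")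
        case True
        then have "x = b i" using i by (simp add: b_def)
        then show ?thesis using i by (simp add: b)
      next
        case False
        then have "x = b (i - 1)" "i - 1 < N" using i \<open>i \<noteq> p\<close> by (auto simp: b_def)
        then show ?thesis by (auto simp: b)
      qed
    qed
  qed
  have "\<Sum>?A' = \<Sum>?A - int n"
    unfolding A' using CA B(1) by (simp add: sum.remove[of ?A B] C_def)
  then have sum': "\<Sum>?A' = \<Sum>?M + int n * int k"
    using Suc.prems(4) by (simp add: algebra_simps)
  \<comment> \<open>The lowered element keeps the partner of \<open>B\<close>.\<close>
  let ?f = "f(C := f B)"
  have inter: "interlaced n N lam' mu ?f"
    unfolding interlaced_def
  proof
    fix x assume x: "x \<in> ?A'"
    show "?f x \<in> ?M \<and> ?f x \<le> x \<and> int n dvd x - ?f x \<and>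
      (\<forall>y\<in>?A'. y < x \<longrightarrow> int n dvd x - y \<longrightarrow> y < ?f x)"
    proof (cases "x = C")
      case True
      have "int n dvd (B - f B) - int n" by (rule dvd_diff[OF F(3)[OF B(1)] dvd_refl])
      moreover have "(B - f B) - int n = C - f B" by (simp add: C_def)
      moreover have "y < f B" if y: "y \<in> ?A'" "y < C" "int n dvd C - y" for y
      proof -
        have "int n dvd (C - y) + int n" by (rule dvd_add[OF y(3) dvd_refl])
        moreover have "(C - y) + int n = B - y" by (simp add: C_def)
        ultimately have "int n dvd B - y" by simp
        then show ?thesis using F(4)[OF B(1), of y] y CB A' by auto
      qed
      ultimately show ?thesis using True F(1)[OF B(1)] fC by simp
    next
      case False
      then have xA: "x \<in> ?A" "x \<noteq> B" using x A' by auto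
      moreover have "y < f x" if y: "y \<in> ?A'" "y < x" "int n dvd x - y" for y
      proof (cases "y = C")
        \<comment> \<open>A congruent \<open>x\<close> above \<open>C\<close> other than
          \<open>B\<close> lies above \<open>B\<close>. By the maximality of \<open>B\<close> it has
          not moved, so \<open>f x = x\<close>.\<close>
        case True
        have "int n dvd (x - y) - (B - C)" using y(3) CB(2) by (rule dvd_diff)
        then have d: "int n dvd x - B" using True by simp
        have "B < x"
        proof (rule ccontr)
          assume "\<not> B < x"
          then have "0 < B - x" using xA by simp
          moreover have "int n dvd B - x" using d by (simp add: dvd_diff_commute)
          ultimately have "int n \<le> B - x" by (rule zdvd_imp_le[rotated])
          then show False using y(2) True by (simp add: C_def)
        qed
        then have "x \<notin> V" using max by force
        then have "f x = x" using xA F(2)[OF xA(1)] by (simp add: V_def)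
        then show ?thesis using y by simp
      next
        case False
        then show ?thesis using y A' F(4)[OF xA(1), of y] by auto
      qed
      ultimately show ?thesis using False F(1-3)[OF xA(1)] by simp
    qed
  qed
  obtain \<alpha> p' q' where ch: "move_chain n N k lam' mu \<alpha> p' q'"
    and bound: "\<And>t. t < k \<Longrightarrow> \<exists>x\<in>?A'. ?f x < x \<and> beta (\<alpha> (Suc t)) (p' t) \<le> x"
    using Suc.IH[OF lam' zero' inter sum'] by blast
  \<comment> \<open>The second conclusion of the induction serves here: earlier targets are bounded
    by elements that have moved in \<open>lam'\<close>, and these all lie below
    \<open>B\<close>.\<close>
  have less_B: "beta (\<alpha> (Suc t)) (p' t) < B" if t: "t < k" for t
  proof -
    obtain x where x: "x \<in> ?A'" "?f x < x" "beta (\<alpha> (Suc t)) (p' t) \<le> x" using bound[OF t] by blast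
    have "x < B"
    proof (cases "x = C")
      case False
      then have "x \<in> V" "x \<noteq> B" using x A' by (auto simp: V_def)
      then show ?thesis using max[of x] by simp
    qed (use CB in simp)
    then show ?thesis using x(3) by simp
  qed
  have lam'_eq: "int (lam' i) = b i + int i" for i using b by (simp add: beta_def fun_eq_iff) (metis add.commute diff_add_cancel)
  have rows: "strip_rows lam' lam p q"
    unfolding strip_rows_def
  proof (intro conjI allI impI)
    show "lam i = lam' i" if "i < p \<or> q < i" for i
      using lam'_eq[of i] that by (simp add: b_def beta_def)
    show "lam (Suc i) = Suc (lam' i)" if "p \<le> i" "i < q" for i
      using lam'_eq[of i] that by (simp add: b_def beta_def)
    show "lam' q < lam q" using lam'_eq[of q] pq q(2) by (simp add: b_def beta_def)
  qed (rule pq)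
  let ?\<alpha> = "\<lambda>t. if t \<le> k then \<alpha> t else lam"
  have ak: "\<alpha> k = lam'" and a0: "\<alpha> 0 = mu" using ch by (auto simp: move_chain_def)
  have bq: "beta lam' q = C" unfolding b using pq by (simp add: b_def)
  have "move_chain n N (Suc k) lam mu ?\<alpha> (p'(k := p)) (q'(k := q))"
    unfolding move_chain_def
  proof (intro conjI allI impI)
    fix t assume "t < Suc k"
    then consider "t < k" | "t = k" by linarith
    then show "strip_rows (?\<alpha> t) (?\<alpha> (Suc t)) ((p'(k := p)) t) ((q'(k := q)) t)"
      "(q'(k := q)) t < N"
      "beta (?\<alpha> (Suc t)) ((p'(k := p)) t) = beta (?\<alpha> t) ((q'(k := q)) t) + int n"
      using ch rows q(1) p(2) bq by (cases; simp add: move_chain_def ak C_def)+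
  next
    fix s t assume "s < t" "t < Suc k"
    then consider "t < k" "s < t" | "t = k" "s < k" by linarith
    then show "beta (?\<alpha> (Suc s)) ((p'(k := p)) s) < beta (?\<alpha> (Suc t)) ((p'(k := p)) t)"
      using ch less_B p(2) by cases (auto simp: move_chain_def)
  qed (use ch lam in \<open>auto simp: move_chain_def\<close>)
  moreover have "\<exists>x\<in>?A. f x < x \<and> beta (?\<alpha> (Suc t)) ((p'(k := p)) t) \<le> x" if "t < Suc k" for t
    using that less_B[of t] p(2) B by (intro bexI[of _ B]) (auto simp: less_Suc_eq)
  ultimately show ?case by blast
qed

subsection \<open>The determinant of the strip matrix\<close>

lemma num_parts_iff:
  assumes "is_partition lam"
  shows "i < num_parts lam \<longleftrightarrow> lam i \<noteq> 0"
proof -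
  obtain N where "lam N = 0" using partition_eventually_zero[OF assms] by blast
  define M where "M = (LEAST i. lam i = 0)"
  have M: "lam M = 0" unfolding M_def by (rule LeastI[of _ N]) fact
  have "lam i \<noteq> 0 \<longleftrightarrow> i < M" for i
    using not_less_Least[of i "\<lambda>i. lam i = 0"] is_partitionD[OF assms, of M i] M
    unfolding M_def[symmetric] by (cases "i < M") auto
  then show ?thesis by (simp add: num_parts_def)
qed

lemma part_size_eq:
  assumes "\<And>i. N \<le> i \<Longrightarrow> lam i = 0"
  shows "part_size lam = (\<Sum>i = 0..<N. lam i)"
  unfolding part_size_def
proof (rule sum.mono_neutral_left)
  show "{i. lam i \<noteq> 0} \<subseteq> {0..<N}" using assms by (metis (mono_tags) atLeastLessThan_iff mem_Collect_eq not_le subsetI zero_le)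
qed auto

lemma sum_beta:
  assumes "is_partition lam" "\<And>i. N \<le> i \<Longrightarrow> lam i = 0"
  shows "\<Sum>(beta lam ` {0..<N}) = int (part_size lam) - (\<Sum>i = 0..<N. int i)"
proof -
  have "\<Sum>(beta lam ` {0..<N}) = (\<Sum>i = 0..<N. beta lam i)"
    by (rule sum.reindex_cong[of "beta lam"]) (auto simp: inj_on_def beta_eq_iff[OF assms(1)])
  then show ?thesis by (simp add: beta_def sum_subtractf part_size_eq[OF assms(2)])
qed

section \<open>The strip matrix in terms of beta numbers\<close>

definition strip_entry :: "nat \<Rightarrow> (nat \<Rightarrow> nat) \<Rightarrow> (nat \<Rightarrow> nat) \<Rightarrow> nat \<Rightarrow> nat \<Rightarrow> 'a::idom" where
  "strip_entry n lam mu i j =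
     (if beta mu j \<le> beta lam i \<and> int n dvd beta lam i - beta mu j then 1 else 0)"

text \<open>The size \<open>N\<close> is free, so that one size can serve all partitions occurring
  in a product.\<close>

definition strip_det :: "nat \<Rightarrow> nat \<Rightarrow> (nat \<Rightarrow> nat) \<Rightarrow> (nat \<Rightarrow> nat) \<Rightarrow> 'a::idom" where
  "strip_det n N lam mu = det (mat N N (\<lambda>(i, j). strip_entry n lam mu i j))"

text \<open>Each additional last row is 0 except for a 1 on the diagonal, because both partitions
  have no part there and the earlier numbers of \<open>mu\<close> are larger.\<close>

lemma det_strip_matrix:
  assumes lam: "is_partition lam" and le: "mu \<le> lam" and N: "num_parts lam \<le> N"
  shows "det (strip_matrix n lam mu) = strip_det n N lam mu"
  using N
proof (induction rule: dec_induct)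
  case base
  show ?case
    unfolding strip_det_def strip_matrix_def
    by (rule arg_cong[where f = det], rule cong_mat) (auto simp: strip_entry_def beta_def algebra_simps)
next
  case (step N)
  have zero: "lam N = 0" "mu N = 0"
    using num_parts_iff[OF lam, of N] step(1) le_funD[OF le, of N] by simp_all
  have "strip_det n (Suc N) lam mu = strip_entry n lam mu N N * (strip_det n N lam mu :: int)"
    unfolding strip_det_def
    by (rule det_last_row) (use zero in \<open>simp add: strip_entry_def beta_def\<close>)
  then show ?case using step.IH zero by (simp add: strip_entry_def beta_def)
qed

text \<open>The inverse of the recorded permutation brings each number of \<open>mu\<close> to the
  row of its final position. A nonzero entry below the diagonal would put a smaller congruent number
  of \<open>lam\<close> at or above the origin of a larger one, against the gap property.\<close>

lemma strip_det_move_chain: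
  assumes ch: "move_chain n N k lam mu \<alpha> p q" and n: "n > 0" and lam: "is_partition lam"
  shows "strip_det n N lam mu = (\<Prod>t<k. (- 1) ^ (q t - p t) :: int)"
proof -
  have ak: "\<alpha> k = lam" using ch by (simp add: move_chain_def)
  obtain \<tau> where \<tau>: "\<tau> permutes {0..<N}" and sgn: "sign \<tau> = (\<Prod>t<k. (- 1) ^ (q t - p t))"
    and up: "\<And>j. j < N \<Longrightarrow> beta mu j \<le> beta lam (\<tau> j)" "\<And>j. j < N \<Longrightarrow> int n dvd beta lam (\<tau> j) - beta mu j"
    and gap: "\<And>j j'. j < N \<Longrightarrow> j' < N \<Longrightarrow> int n dvd beta lam (\<tau> j) - beta lam (\<tau> j') \<Longrightarrow>
       beta lam (\<tau> j') < beta lam (\<tau> j) \<Longrightarrow> beta lam (\<tau> j') < beta mu j"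
    using move_chain_permutation[OF ch n order_refl] unfolding ak by auto
  define \<sigma> where "\<sigma> = inv_into UNIV \<tau>"
  have \<sigma>: "\<sigma> permutes {0..<N}" unfolding \<sigma>_def by (rule permutes_inv[OF \<tau>])
  have \<tau>\<sigma>: "\<tau> (\<sigma> j) = j" for j unfolding \<sigma>_def by (rule permutes_inverses(1)[OF \<tau>])
  have \<sigma>N: "\<sigma> j < N" if "j < N" for j using permutes_in_image[OF \<sigma>, of j] that by simp
  have "det (mat N N (\<lambda>(i, j). strip_entry n lam mu i (\<sigma> j))) = (1 :: int)"
  proof (rule det_unitriangular)
    show "strip_entry n lam mu i (\<sigma> i) = (1 :: int)" if "i < N" for i
      using up[OF \<sigma>N[OF that]] by (simp add: \<tau>\<sigma> strip_entry_def)
    show "strip_entry n lam mu i (\<sigma> j) = (0 :: int)" if "j < i" "i < N" for i j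
    proof (rule ccontr)
      assume "strip_entry n lam mu i (\<sigma> j) \<noteq> (0 :: int)"
      then have e: "beta mu (\<sigma> j) \<le> beta lam i" "int n dvd beta lam i - beta mu (\<sigma> j)"
        by (auto simp: strip_entry_def split: if_splits)
      have "int n dvd (beta lam j - beta mu (\<sigma> j)) - (beta lam i - beta mu (\<sigma> j))"
        using up(2)[OF \<sigma>N, of j] that by (intro dvd_diff[OF _ e(2)]) (simp add: \<tau>\<sigma>)
      then have "beta lam i < beta mu (\<sigma> j)"
        using gap[OF \<sigma>N \<sigma>N, of j i] that beta_strict[OF lam that(1)] by (simp add: \<tau>\<sigma>)
      then show False using e(1) by simp
    qed
  qed
  then have "sign \<sigma> * strip_det n N lam mu = (1 :: int)"
    unfolding strip_det_def using det_permute_columns[OF \<sigma>, of "strip_entry n lam mu :: nat \<Rightarrow> nat \<Rightarrow> int"] by simp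
  moreover have "sign \<sigma> = sign \<tau>"
    unfolding \<sigma>_def using \<tau> by (intro sign_inverse) (auto simp: permutation_permutes)
  moreover have "sign \<tau> * sign \<tau> = 1" by (rule sign_idempotent)
  ultimately show ?thesis unfolding sgn[symmetric]
    by (metis mult.assoc mult.right_neutral mult_1)
qed

text \<open>If no number of \<open>mu\<close> lies between \<open>beta lam i\<close> and the next
  lower congruent number of \<open>lam\<close>, then row \<open>i\<close> equals the row of that
  number, or is zero when there is none. Both would make the determinant vanish.\<close>

lemma interlaced_of_strip_det:
  assumes lam: "is_partition lam" and nz: "strip_det n N lam mu \<noteq> (0 :: int)"
  shows "\<exists>f. interlaced n N lam mu f"
proof -
  let ?l = "beta lam" and ?m = "beta mu"
  have row: "\<exists>j<N. ?m j \<le> ?l i \<and> int n dvd ?l i - ?m j \<and>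
      (\<forall>i'<N. i < i' \<longrightarrow> int n dvd ?l i - ?l i' \<longrightarrow> ?l i' < ?m j)" if i: "i < N" for i
  proof (rule ccontr)
    assume none: "\<not> ?thesis"
    show False
    proof (cases "\<exists>i'<N. i < i' \<and> int n dvd ?l i - ?l i'")
      case True
      \<comment> \<open>The row of the next lower number in the residue class of
        \<open>?l i\<close>; a smaller index means a larger number.\<close>
      define i0 where "i0 = (LEAST i'. i' < N \<and> i < i' \<and> int n dvd ?l i - ?l i')"
      have i0: "i0 < N" "i < i0" "int n dvd ?l i - ?l i0"
        using LeastI_ex[OF True] unfolding i0_def by auto
      have least: "i0 \<le> i'" if "i' < N" "i < i'" "int n dvd ?l i - ?l i'" for i'
        unfolding i0_def using that by (intro Least_le) auto
      have "(strip_entry n lam mu i j :: int) = strip_entry n lam mu i0 j" if j: "j < N" for j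
      proof -
        have dvd: "int n dvd ?l i - ?m j \<longleftrightarrow> int n dvd ?l i0 - ?m j"
        proof -
          have "?l i - ?m j = (?l i - ?l i0) + (?l i0 - ?m j)" by simp
          then show ?thesis using i0(3) by (metis dvd_add_right_iff)
        qed
        have "?m j \<le> ?l i \<and> int n dvd ?l i - ?m j \<longleftrightarrow> ?m j \<le> ?l i0 \<and> int n dvd ?l i0 - ?m j"
        proof
          assume "?m j \<le> ?l i0 \<and> int n dvd ?l i0 - ?m j"
          then show "?m j \<le> ?l i \<and> int n dvd ?l i - ?m j"
            using beta_strict[OF lam i0(2)] dvd by simp
        next
          \<comment> \<open>Since column \<open>j\<close> is not admissible, \<open>?m j\<close> is
            at most some lower congruent \<open>?l i'\<close>, hence at most the largest of
            these.\<close>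
          assume a: "?m j \<le> ?l i \<and> int n dvd ?l i - ?m j"
          then obtain i' where i': "i' < N" "i < i'" "int n dvd ?l i - ?l i'" "?m j \<le> ?l i'"
            using none j by (meson not_le)
          have "?l i' \<le> ?l i0"
            using least[OF i'(1-3)] beta_strict[OF lam, of i0 i'] by (cases "i0 = i'") auto
          then show "?m j \<le> ?l i0 \<and> int n dvd ?l i0 - ?m j" using a dvd i'(4) by simp
        qed
        then show ?thesis by (simp add: strip_entry_def)
      qed
      then have "strip_det n N lam mu = (0 :: int)"
        unfolding strip_det_def using i0 i
        by (intro det_identical_rows[of _ N i i0]) (auto intro!: eq_vecI)
      then show False using nz by simp
    next
      case False
      then have "(strip_entry n lam mu i j :: int) = 0" if "j < N" for j
        using none that by (auto simp: strip_entry_def)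
      then have "strip_det n N lam mu = (0 :: int)"
        unfolding strip_det_def using i by (subst laplace_expansion_row[of _ N i]) auto
      then show False using nz by simp
    qed
  qed
  have "\<exists>z. z \<in> ?m ` {0..<N} \<and> z \<le> x \<and> int n dvd x - z \<and>
      (\<forall>y\<in>?l ` {0..<N}. y < x \<longrightarrow> int n dvd x - y \<longrightarrow> y < z)" if x: "x \<in> ?l ` {0..<N}" for x
  proof -
    obtain i where i: "i < N" "x = ?l i" using x by auto
    then obtain j where j: "j < N" "?m j \<le> ?l i" "int n dvd ?l i - ?m j"
      "\<And>i'. i' < N \<Longrightarrow> i < i' \<Longrightarrow> int n dvd ?l i - ?l i' \<Longrightarrow> ?l i' < ?m j"
      using row by blast
    then show ?thesis using i by (intro exI[of _ "?m j"]) (auto simp: beta_less_iff[OF lam])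
  qed
  then show ?thesis unfolding interlaced_def by metis
qed

section \<open>Translation between the two notions of chain\<close>

lemma strip_rows_le: "strip_rows al be p q \<Longrightarrow> is_partition be \<Longrightarrow> al \<le> be"
proof (rule le_funI)
  fix i assume "strip_rows al be p q" "is_partition be"
  then show "al i \<le> be i"
    using strip_rows_less[of al be p q i] by (cases "p \<le> i \<and> i \<le> q") (auto simp: strip_rows_def)
qed

lemma chain_mono:
  assumes "\<And>t. t < k \<Longrightarrow> \<alpha> t \<le> (\<alpha> (Suc t) :: nat \<Rightarrow> nat)" "s \<le> t" "t \<le> k"
  shows "\<alpha> s \<le> \<alpha> t"
  using assms(2,3)
proof (induction rule: dec_induct)
  case (step t)
  then show ?case using assms(1)[of t] by (auto intro: order_trans)
qed simp

text \<open>The target of a move is one more than column minus row of the starting box, a quantity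
  that grows strictly from a box to any box northeast of it in the sense of
  \<open>southwest\<close>.\<close>

lemma move_chain_of_strip_chain:
  assumes ch: "strip_chain n k lam mu \<alpha>" and n: "n > 0" and zero: "\<And>i. N \<le> i \<Longrightarrow> lam i = 0"
  shows "\<exists>p q. move_chain n N k lam mu \<alpha> p q \<and>
    (\<forall>t<k. strip_height (skew (\<alpha> (Suc t)) (\<alpha> t)) = q t - p t)"
proof -
  have part: "is_partition (\<alpha> t)" if "t \<le> k" for t using ch that by (simp add: strip_chain_def)
  have le: "\<alpha> t \<le> \<alpha> (Suc t)" and border: "border_strip n (skew (\<alpha> (Suc t)) (\<alpha> t))" if "t < k" for t
    using ch that by (auto simp: strip_chain_def)
  have sw: "southwest (starting_box (skew (\<alpha> (Suc s)) (\<alpha> s))) (starting_box (skew (\<alpha> (Suc t)) (\<alpha> t)))"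
    if "s < t" "t < k" for s t using ch that by (simp add: strip_chain_def)
  have "\<forall>t. \<exists>p q. t < k \<longrightarrow> strip_rows (\<alpha> t) (\<alpha> (Suc t)) p q \<and> beta (\<alpha> (Suc t)) p = beta (\<alpha> t) q + int n"
    using border_strip_rows[OF part part le n border] by (metis Suc_leI less_imp_le)
  then obtain p q where pq: "\<And>t. t < k \<Longrightarrow> strip_rows (\<alpha> t) (\<alpha> (Suc t)) (p t) (q t)"
    "\<And>t. t < k \<Longrightarrow> beta (\<alpha> (Suc t)) (p t) = beta (\<alpha> t) (q t) + int n" by metis
  have start: "starting_box (skew (\<alpha> (Suc t)) (\<alpha> t)) = (p t, \<alpha> (Suc t) (p t) - 1)"
    "0 < \<alpha> (Suc t) (p t)" if "t < k" for t
    using strip_rows_starting_box[OF pq(1)] strip_rows_less[OF pq(1), of t "p t"] pq(1)[OF that] that part[of "Suc t"]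
    by (auto simp: strip_rows_def)
  have "q t < N" if t: "t < k" for t
  proof -
    have "\<alpha> (Suc t) \<le> \<alpha> k" by (rule chain_mono[of k \<alpha>, OF le]) (use t in auto)
    then have "\<alpha> (Suc t) (q t) \<le> lam (q t)" using ch by (simp add: strip_chain_def le_fun_def)
    \<comment> \<open>Row \<open>q t\<close> gains boxes, so it is a nonempty row of
      \<open>lam\<close>.\<close>
    moreover have "\<alpha> t (q t) < \<alpha> (Suc t) (q t)" using pq(1)[OF t] by (simp add: strip_rows_def)
    ultimately show ?thesis using zero[of "q t"] by (cases "q t < N") auto
  qed
  moreover have "beta (\<alpha> (Suc s)) (p s) < beta (\<alpha> (Suc t)) (p t)" if "s < t" "t < k" for s t
    using sw[OF that] start[of s] start[of t] that by (auto simp: southwest_def beta_def)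
  moreover have "strip_height (skew (\<alpha> (Suc t)) (\<alpha> t)) = q t - p t" if "t < k" for t
    using strip_rows_height[OF pq(1)[OF that]] part that by simp
  ultimately show ?thesis
    using ch pq by (intro exI[of _ p] exI[of _ q]) (auto simp: move_chain_def strip_chain_def)
qed

text \<open>Increasing targets force each strip to start weakly above and strictly to the right of
  its predecessor. This is shown for consecutive strips and extended by transitivity.\<close>

lemma strip_chain_of_move_chain:
  assumes ch: "move_chain n N k lam mu \<alpha> p q"
  shows "strip_chain n k lam mu \<alpha>"
proof -
  have part: "is_partition (\<alpha> t)" if "t \<le> k" for t using ch that by (simp add: move_chain_def)
  have rows: "strip_rows (\<alpha> t) (\<alpha> (Suc t)) (p t) (q t)"
    and target: "beta (\<alpha> (Suc t)) (p t) = beta (\<alpha> t) (q t) + int n" if "t < k" for t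
    using ch that by (auto simp: move_chain_def)
  have incr: "beta (\<alpha> (Suc s)) (p s) < beta (\<alpha> (Suc t)) (p t)" if "s < t" "t < k" for s t
    using ch that unfolding move_chain_def by blast
  have ends: "\<alpha> 0 = mu" "\<alpha> k = lam" using ch by (auto simp: move_chain_def)
  have le: "\<alpha> t \<le> \<alpha> (Suc t)" if "t < k" for t
    using strip_rows_le[OF rows[OF that]] part that by simp
  have mono: "\<alpha> s i \<le> \<alpha> t i" if "s \<le> t" "t \<le> k" for s t i
    using chain_mono[of k \<alpha>, OF le that] by (simp add: le_fun_def)
  have pq: "p t \<le> q t" if "t < k" for t using rows[OF that] by (simp add: strip_rows_def)
  have grow: "\<alpha> t i < \<alpha> (Suc t) i" if "t < k" "p t \<le> i" "i \<le> q t" for t i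
    using strip_rows_less[OF rows[OF that(1)]] part that by simp
  have keep: "\<alpha> (Suc t) i = \<alpha> t i" if "t < k" "i < p t \<or> q t < i" for t i
    using rows[OF that(1)] that(2) unfolding strip_rows_def by blast
  have start: "starting_box (skew (\<alpha> (Suc t)) (\<alpha> t)) = (p t, \<alpha> (Suc t) (p t) - 1)" if "t < k" for t
    using strip_rows_starting_box[OF rows[OF that]] part that by simp
  have step: "p (Suc t) \<le> p t \<and> \<alpha> (Suc t) (p t) < \<alpha> (Suc (Suc t)) (p (Suc t))" if t: "Suc t < k" for t
  proof
    show p: "p (Suc t) \<le> p t"
    \<comment> \<open>Otherwise row \<open>p t\<close> would keep the previous target, and being the
      higher row it would exceed the new target.\<close>
    proof (rule ccontr)
      assume n: "\<not> ?thesis"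
      then have "\<alpha> (Suc (Suc t)) (p t) = \<alpha> (Suc t) (p t)" using keep[OF t, of "p t"] by simp
      then have "beta (\<alpha> (Suc (Suc t))) (p t) = beta (\<alpha> (Suc t)) (p t)" by (simp add: beta_def)
      then show False
        using incr[of t "Suc t"] t n beta_strict[OF part, of "Suc (Suc t)" "p t" "p (Suc t)"] by simp
    qed
    show "\<alpha> (Suc t) (p t) < \<alpha> (Suc (Suc t)) (p (Suc t))"
    proof (cases "p t \<le> q (Suc t)")
      case True
      then have "\<alpha> (Suc t) (p t) < \<alpha> (Suc (Suc t)) (p t)" using grow[OF t p] by simp
      also have "\<dots> \<le> \<alpha> (Suc (Suc t)) (p (Suc t))"
        using is_partitionD[OF part[of "Suc (Suc t)"] p] t by simp
      finally show ?thesis .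
    next
      case False
      have "\<alpha> (Suc t) (p t) \<le> \<alpha> (Suc t) (p (Suc t))"
        using is_partitionD[OF part[of "Suc t"] p] t by simp
      also have "\<dots> < \<alpha> (Suc (Suc t)) (p (Suc t))" by (rule grow[OF t order_refl pq[OF t]])
      finally show ?thesis .
    qed
  qed
  have sw: "p t \<le> p s \<and> \<alpha> (Suc s) (p s) < \<alpha> (Suc t) (p t)" if "s < t" "t < k" for s t
    using that
  proof (induction rule: less_Suc_induct)
    case (1 t)
    then show ?case using step by simp
  next
    case (2 r s t)
    then show ?case by simp
  qed
  have pos: "0 < \<alpha> (Suc t) (p t)" if "t < k" for t using grow[OF that order_refl pq[OF that]] by simp
  have top: "(p t, \<alpha> (Suc t) (p t) - 1) \<in> top_boxes (skew lam mu)" if t: "t < k" for t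
  proof -
    let ?c = "\<alpha> (Suc t) (p t) - 1"
    have "mu (p t) \<le> \<alpha> t (p t)" "\<alpha> (Suc t) (p t) \<le> lam (p t)"
      using mono[of 0 t "p t"] mono[of "Suc t" k "p t"] t by (simp_all add: ends)
    then have "(p t, ?c) \<in> skew lam mu"
      using grow[OF t order_refl pq[OF t]] by (auto simp: skew_iff)
    \<comment> \<open>A higher box of \<open>skew lam mu\<close> in this column would come from an
      earlier strip, since strip \<open>t\<close> leaves row \<open>i\<close> unchanged. But the
      starting box of an earlier strip, and with it the whole strip, lies strictly to the left of
      the column.\<close>
    moreover have "p t \<le> i" if i: "(i, ?c) \<in> skew lam mu" for i
    proof (rule ccontr)
      assume "\<not> p t \<le> i"
      then have ip: "i < p t" by simp
      have "\<alpha> (Suc t) (p t) \<le> \<alpha> (Suc t) i"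
        using is_partitionD[OF part[of "Suc t"], of i "p t"] t ip by simp
      then have "?c < \<alpha> t i" using keep[OF t, of i] ip pos[OF t] by simp
      moreover have "\<not> ?c < \<alpha> 0 i" using i by (simp add: skew_iff ends)
      ultimately obtain s where s: "s < t" "\<not> ?c < \<alpha> s i" "?c < \<alpha> (Suc s) i"
        using ex_least_nat_less[of "\<lambda>s. ?c < \<alpha> s i" t] by auto
      then have "p s \<le> i" using keep[of s i] t by (metis less_trans not_le)
      then have "\<alpha> (Suc s) i \<le> \<alpha> (Suc s) (p s)"
        using is_partitionD[OF part[of "Suc s"], of "p s" i] s t by simp
      then show False using sw[OF s(1) t, THEN conjunct2] s(3) by linarith
    qed
    ultimately show ?thesis by (auto simp: top_boxes_def)
  qed
  have "border_strip n (skew (\<alpha> (Suc t)) (\<alpha> t))" if "t < k" for t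
    using border_strip_of_rows[OF rows[OF that] _ _ target[OF that]] part that by simp
  moreover have "southwest (p s, \<alpha> (Suc s) (p s) - 1) (p t, \<alpha> (Suc t) (p t) - 1)"
    if "s < t" "t < k" for s t
    using sw[OF that] pos[of s] that by (auto simp: southwest_def)
  ultimately show ?thesis
    using ends part le top by (auto simp: strip_chain_def start)
qed

text \<open>The determinant equals the product of signs of every chain, in particular of the one
  selected in \<open>strip_sign\<close>. A nonzero determinant conversely yields an interlacing
  matching and thus a chain.\<close>

theorem det_strip_matrix_eq_sign:
  assumes n: "n > 0" and lam: "is_partition lam" and mu: "is_partition mu" and le: "mu \<le> lam"
    and size: "part_size lam = part_size mu + n * k"
  shows "det (strip_matrix n lam mu) =
    (if horizontal_border_strip n k lam mu then strip_sign n k lam mu else 0)"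
proof -
  define N where "N = num_parts lam"
  have zl: "lam i = 0" if "N \<le> i" for i using num_parts_iff[OF lam, of i] that by (simp add: N_def)
  have zm: "mu i = 0" if "N \<le> i" for i using zl[OF that] le_funD[OF le, of i] by simp
  have det: "det (strip_matrix n lam mu) = strip_det n N lam mu"
    unfolding N_def by (rule det_strip_matrix[OF lam le order_refl])
  show ?thesis
  proof (cases "horizontal_border_strip n k lam mu")
    case True
    define \<alpha> where "\<alpha> = (SOME \<alpha>. strip_chain n k lam mu \<alpha>)"
    have "strip_chain n k lam mu \<alpha>"
      using True unfolding \<alpha>_def horizontal_border_strip_def by (rule someI_ex)
    then obtain p q where ch: "move_chain n N k lam mu \<alpha> p q"
      and ht: "\<And>t. t < k \<Longrightarrow> strip_height (skew (\<alpha> (Suc t)) (\<alpha> t)) = q t - p t"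
      using move_chain_of_strip_chain[of n k lam mu \<alpha> N, OF _ n zl] by blast
    have "strip_sign n k lam mu = (\<Prod>t<k. (- 1) ^ (q t - p t))"
      unfolding strip_sign_def Let_def \<alpha>_def[symmetric] using ht by (intro prod.cong) auto
    then show ?thesis using True det strip_det_move_chain[OF ch n lam] by simp
  next
    case False
    have "strip_det n N lam mu = (0 :: int)"
    proof (rule ccontr)
      assume "strip_det n N lam mu \<noteq> (0 :: int)"
      then obtain f where f: "interlaced n N lam mu f"
        using interlaced_of_strip_det[OF lam] by blast
      have "\<Sum>(beta lam ` {0..<N}) = \<Sum>(beta mu ` {0..<N}) + int n * int k"
        by (simp add: sum_beta[OF lam zl] sum_beta[OF mu zm] size)
      then obtain \<alpha> p q where "move_chain n N k lam mu \<alpha> p q"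
        using move_chain_exists[OF lam mu n zl zm f] by blast
      then show False
        using False strip_chain_of_move_chain unfolding horizontal_border_strip_def by blast
    qed
    then show ?thesis using False det by simp
  qed
qed

subsection \<open>The product of an alternant with a plethysm\<close>

text \<open>Weak compositions, that is, exponent vectors of degree \<open>k\<close> in
  \<open>N\<close> variables, extended by 0 so that each one is counted once.\<close>

definition compositions :: "nat \<Rightarrow> nat \<Rightarrow> (nat \<Rightarrow> nat) set" where
  "compositions N k = {e. (\<forall>i\<ge>N. e i = 0) \<and> (\<Sum>i = 0..<N. e i) = k}"

lemma finite_compositions: "finite (compositions N k)"
proof (rule finite_subset)
  let ?F = "{e. \<forall>i. (i \<in> {0..<N} \<longrightarrow> e i \<in> {..k}) \<and> (i \<notin> {0..<N} \<longrightarrow> e i = (0::nat))}"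
  have "e i \<le> k" if "(\<Sum>i = 0..<N. e i) = k" "i < N" for e :: "nat \<Rightarrow> nat" and i
    using member_le_sum[of i "{0..<N}" e] that by simp
  then show "compositions N k \<subseteq> ?F" by (auto simp: compositions_def)
  show "finite ?F" by (rule finite_set_of_finite_funs) auto
qed

text \<open>The value of \<open>p\<^sub>n \<circ> h\<^sub>k\<close> at \<open>x 0, \<dots>, x (N - 1)\<close>.\<close>

definition plethysm_poly :: "nat \<Rightarrow> nat \<Rightarrow> nat \<Rightarrow> (nat \<Rightarrow> 'a::idom) \<Rightarrow> 'a" where
  "plethysm_poly n k N x = (\<Sum>e\<in>compositions N k. \<Prod>i = 0..<N. x i ^ (n * e i))"

lemma plethysm_poly_permute:
  assumes p: "p permutes {0..<N}"
  shows "plethysm_poly n k N x = plethysm_poly n k N (\<lambda>i. x (p i))"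
proof -
  have comp: "e \<circ> r \<in> compositions N k" if e: "e \<in> compositions N k" and r: "r permutes {0..<N}" for e r
  proof -
    have "r i = i" if "N \<le> i" for i using permutes_not_in[OF r, of i] that by simp
    moreover have "(\<Sum>i = 0..<N. (e \<circ> r) i) = (\<Sum>i = 0..<N. e i)" by (rule sum.permute[OF r, symmetric])
    ultimately show ?thesis using e by (simp add: compositions_def)
  qed
  let ?q = "inv_into UNIV p"
  note q = permutes_inv[OF p]
  show ?thesis
    unfolding plethysm_poly_def
  proof (rule sum.reindex_bij_witness[of _ "\<lambda>e. e \<circ> ?q" "\<lambda>e. e \<circ> p"])
    fix e assume "e \<in> compositions N k"
    then show "e \<circ> p \<in> compositions N k" "e \<circ> ?q \<in> compositions N k" by (auto intro: comp p q)
    show "e \<circ> p \<circ> ?q = e" "e \<circ> ?q \<circ> p = e" by (auto simp: permutes_inverses[OF p])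
    show "(\<Prod>i = 0..<N. x (p i) ^ (n * (e \<circ> p) i)) = (\<Prod>i = 0..<N. x i ^ (n * e i))"
      using prod.permute[OF p, of "\<lambda>i. x i ^ (n * e i)"] by (simp add: o_def)
  qed
qed

text \<open>By symmetry the factor may be evaluated at the permuted variables of each Leibniz term,
  where its exponents add to those of the term.\<close>

lemma plethysm_poly_mult_alternant:
  "plethysm_poly n k N x * alternant N x l =
     (\<Sum>e\<in>compositions N k. alternant N x (\<lambda>i. l i + n * e i))"
proof -
  have "plethysm_poly n k N x * alternant N x l = (\<Sum>p | p permutes {0..<N}.
      of_int (sign p) * (plethysm_poly n k N (\<lambda>i. x (p i)) * (\<Prod>i = 0..<N. x (p i) ^ l i)))"
    unfolding alternant_def det_mat_Leibniz sum_distrib_left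
    by (rule sum.cong[OF refl]) (use plethysm_poly_permute[of _ N n k x] in \<open>simp add: mult_ac\<close>)
  also have "\<dots> = (\<Sum>p | p permutes {0..<N}. \<Sum>e\<in>compositions N k.
      of_int (sign p) * (\<Prod>i = 0..<N. x (p i) ^ (l i + n * e i)))"
    unfolding plethysm_poly_def sum_distrib_left sum_distrib_right
    by (simp only: power_add prod.distrib mult_ac)
  also have "\<dots> = (\<Sum>e\<in>compositions N k. alternant N x (\<lambda>i. l i + n * e i))"
    unfolding alternant_def det_mat_Leibniz by (rule sum.swap)
  finally show ?thesis .
qed

section \<open>Sorting exponents into partitions\<close>

lemma decreasing_rearrangement:
  fixes l :: "nat \<Rightarrow> nat"
  assumes inj: "inj_on l {0..<N}"
  obtains p where "p permutes {0..<N}" "\<And>i j. i < j \<Longrightarrow> j < N \<Longrightarrow> l (p j) < l (p i)"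
proof -
  let ?A = "l ` {0..<N}"
  define ys where "ys = rev (sorted_list_of_set ?A)"
  have len: "length ys = N" by (simp add: ys_def card_image[OF inj])
  have set: "set ys = ?A" by (simp add: ys_def)
  have dist: "distinct ys" by (simp add: ys_def)
  have "sorted_wrt (<) (sorted_list_of_set ?A)" by (rule strict_sorted_list_of_set)
  then have "sorted_wrt (\<lambda>x y. y < x) ys" by (simp add: ys_def sorted_wrt_rev)
  then have dec: "ys ! j < ys ! i" if "i < j" "j < N" for i j
    using that sorted_wrt_nth_less len by metis
  define p where "p i = (if i < N then inv_into {0..<N} l (ys ! i) else i)" for i
  have mem: "ys ! i \<in> ?A" if "i < N" for i using that len set by (metis nth_mem)
  have lp: "l (p i) = ys ! i" if "i < N" for i
    using f_inv_into_f[OF mem[OF that]] that by (simp add: p_def)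
  have in_range: "p i \<in> {0..<N}" if "i < N" for i
    using inv_into_into[OF mem[OF that]] that by (simp add: p_def)
  have "inj_on p {0..<N}"
  proof (rule inj_onI)
    fix i j assume ij: "i \<in> {0..<N}" "j \<in> {0..<N}" "p i = p j"
    then have "ys ! i = ys ! j" using lp[of i] lp[of j] by simp
    then show "i = j" using dist ij len by (simp add: nth_eq_iff_index_eq)
  qed
  moreover have "p ` {0..<N} \<subseteq> {0..<N}" using in_range by auto
  ultimately have "bij_betw p {0..<N} {0..<N}"
    by (simp add: bij_betw_def endo_inj_surj)
  then have "p permutes {0..<N}" by (rule bij_imp_permutes) (simp add: p_def)
  moreover have "l (p j) < l (p i)" if "i < j" "j < N" for i j
    using dec[OF that] lp[of i] lp[of j] that by simp
  ultimately show ?thesis by (rule that)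
qed

lemma shifted_beta: "i < N \<Longrightarrow> int (shifted N lam i) = beta lam i + int N - 1"
  by (simp add: shifted_def beta_def)

lemma shifted_less_iff:
  "is_partition lam \<Longrightarrow> i < N \<Longrightarrow> j < N \<Longrightarrow> shifted N lam i < shifted N lam j \<longleftrightarrow> j < i"
  using shifted_beta[of i N lam] shifted_beta[of j N lam] beta_less_iff[of lam i j] by linarith

lemma sum_shifted:
  assumes "\<And>i. N \<le> i \<Longrightarrow> lam i = 0"
  shows "(\<Sum>i = 0..<N. shifted N lam i) = part_size lam + (\<Sum>i = 0..<N. N - Suc i)"
proof -
  have "part_size lam = (\<Sum>i = 0..<N. lam i)" by (rule part_size_eq) (rule assms)
  then show ?thesis by (simp only: shifted_def sum.distrib)
qed

context
  fixes n k N :: nat and mu :: "nat \<Rightarrow> nat"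
  assumes n: "n > 0" and mu: "is_partition mu" and mu0: "\<And>i. N \<le> i \<Longrightarrow> mu i = 0"
begin

definition targets :: "(nat \<Rightarrow> nat) set" where
  "targets = {lam. is_partition lam \<and> part_size lam = part_size mu + n * k \<and>
     mu \<le> lam \<and> (\<forall>i\<ge>N. lam i = 0)}"

text \<open>These are the permutations whose Leibniz term in the transposed strip matrix is nonzero;
  \<open>p\<close> sends a row of \<open>mu\<close> to a row of \<open>lam\<close>.\<close>

definition matchings :: "(nat \<Rightarrow> nat) \<Rightarrow> (nat \<Rightarrow> nat) set" where
  "matchings lam = {p. p permutes {0..<N} \<and>
     (\<forall>j<N. shifted N mu j \<le> shifted N lam (p j) \<and> n dvd shifted N lam (p j) - shifted N mu j)}"

text \<open>The composition \<open>e\<close> for which \<open>shifted N mu + n * e\<close> is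
  \<open>shifted N lam\<close> rearranged by the matching \<open>p\<close>.\<close>

definition steps :: "(nat \<Rightarrow> nat) \<times> (nat \<Rightarrow> nat) \<Rightarrow> nat \<Rightarrow> nat" where
  "steps = (\<lambda>(lam, p) j. if j < N then (shifted N lam (p j) - shifted N mu j) div n else 0)"

lemma steps_eq:
  assumes "p \<in> matchings lam" "j < N"
  shows "shifted N mu j + n * steps (lam, p) j = shifted N lam (p j)"
  using assms by (simp add: matchings_def steps_def)

lemma steps_in:
  assumes lam: "lam \<in> targets" and p: "p \<in> matchings lam"
  shows "steps (lam, p) \<in> compositions N k"
    "inj_on (\<lambda>j. shifted N mu j + n * steps (lam, p) j) {0..<N}"
proof -
  have perm: "p permutes {0..<N}" using p by (simp add: matchings_def)
  have part: "is_partition lam" and size: "part_size lam = part_size mu + n * k"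
    and zero: "\<And>i. N \<le> i \<Longrightarrow> lam i = 0"
    using lam by (auto simp: targets_def)
  have "(\<Sum>j = 0..<N. shifted N mu j + n * steps (lam, p) j) = (\<Sum>j = 0..<N. shifted N lam (p j))"
    using steps_eq[OF p] by (intro sum.cong) auto
  also have "\<dots> = (\<Sum>j = 0..<N. shifted N lam j)"
    using sum.permute[OF perm, of "shifted N lam"] by (simp add: o_def)
  finally have "n * (\<Sum>j = 0..<N. steps (lam, p) j) = n * k"
    by (simp add: sum.distrib sum_shifted[OF mu0] sum_shifted[OF zero] size flip: sum_distrib_left)
  then show "steps (lam, p) \<in> compositions N k"
    using n by (simp add: compositions_def steps_def)
  show "inj_on (\<lambda>j. shifted N mu j + n * steps (lam, p) j) {0..<N}"
  proof (rule inj_onI)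
    fix i j assume ij: "i \<in> {0..<N}" "j \<in> {0..<N}"
      "shifted N mu i + n * steps (lam, p) i = shifted N mu j + n * steps (lam, p) j"
    then have e: "shifted N lam (p i) = shifted N lam (p j)" by (simp add: steps_eq[OF p])
    have "p i < N" "p j < N" using ij permutes_in_image[OF perm] by auto
    then have "p i = p j"
      using e shifted_less_iff[OF part, of "p i" N "p j"] shifted_less_iff[OF part, of "p j" N "p i"]
      by (metis less_irrefl nat_neq_iff)
    then show "i = j" using permutes_inj[OF perm] by (auto dest: injD)
  qed
qed

text \<open>The exponents reached from \<open>mu\<close> determine \<open>lam\<close> by their set
  and then \<open>p\<close> by their arrangement.\<close>

lemma inj_on_steps: "inj_on steps (SIGMA lam:targets. matchings lam)"
proof (rule inj_onI, clarify)
  fix lam p lam' p'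
  assume lam: "lam \<in> targets" "lam' \<in> targets" and p: "p \<in> matchings lam" "p' \<in> matchings lam'"
    and e: "steps (lam, p) = steps (lam', p')"
  have perm: "p permutes {0..<N}" "p' permutes {0..<N}" using p by (simp_all add: matchings_def)
  have part: "is_partition lam" "is_partition lam'" using lam by (simp_all add: targets_def)
  have zero: "\<And>i. N \<le> i \<Longrightarrow> lam i = 0" "\<And>i. N \<le> i \<Longrightarrow> lam' i = 0"
    using lam by (simp_all add: targets_def)
  have lt: "p j < N" "p' j < N" if "j < N" for j
    using that permutes_in_image[OF perm(1), of j] permutes_in_image[OF perm(2), of j] by auto
  have b: "beta lam (p j) = beta lam' (p' j)" if "j < N" for j
  proof -
    have "shifted N lam (p j) = shifted N lam' (p' j)"
      using steps_eq[OF p(1) that] steps_eq[OF p(2) that] e by simp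
    then show ?thesis
      using shifted_beta[OF lt(1)[OF that], of lam] shifted_beta[OF lt(2)[OF that], of lam'] by simp
  qed
  have "beta lam ` {0..<N} = beta lam ` p ` {0..<N}" by (simp add: permutes_image[OF perm(1)])
  also have "\<dots> = beta lam' ` p' ` {0..<N}" using b by (auto simp: image_image)
  also have "\<dots> = beta lam' ` {0..<N}" by (simp add: permutes_image[OF perm(2)])
  finally have "beta lam ` {0..<N} = beta lam' ` {0..<N}" .
  then have eq: "lam = lam'"
    using zero by (intro partition_eqI_beta_image[of lam lam' N] part) auto
  have "p j = p' j" for j
  proof (cases "j < N")
    case True
    then show ?thesis using b[OF True] beta_eq_iff[OF part(1), of "p j" "p' j"] eq by simp
  next
    case False
    then show ?thesis using permutes_not_in[OF perm(1), of j] permutes_not_in[OF perm(2), of j] by simp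
  qed
  then show "lam = lam' \<and> p = p'" using eq by auto
qed

text \<open>Sorting the distinct exponents produces \<open>shifted N lam\<close>, and the inverse of
  the sorting permutation is the matching.\<close>

lemma steps_surj:
  assumes e: "e \<in> compositions N k" and inj: "inj_on (\<lambda>j. shifted N mu j + n * e j) {0..<N}"
  shows "e \<in> steps ` (SIGMA lam:targets. matchings lam)"
proof -
  let ?l = "\<lambda>j. shifted N mu j + n * e j"
  obtain r where r: "r permutes {0..<N}" and dec: "\<And>i j. i < j \<Longrightarrow> j < N \<Longrightarrow> ?l (r j) < ?l (r i)"
    using decreasing_rearrangement[OF inj] by blast
  define p where "p = inv_into UNIV r"
  have p: "p permutes {0..<N}" unfolding p_def by (rule permutes_inv[OF r])
  have rp: "r (p j) = j" for j unfolding p_def by (rule permutes_inverses(1)[OF r])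
  have pN: "p j < N" if "j < N" for j using permutes_in_image[OF p, of j] that by simp
  define L where "L i = ?l (r i)" for i
  \<comment> \<open>For \<open>i < N\<close> this undoes the shift relating \<open>shifted\<close>
    to \<open>beta\<close>; the default \<open>- int i\<close> stands for empty rows.\<close>
  define b where "b i = (if i < N then int (L i) - int N + 1 else - int i)" for i
  define lam where "lam = (\<lambda>i. nat (b i + int i))"
  have "b (Suc i) < b i" for i
  proof -
    consider "Suc i < N" | "Suc i = N" | "N \<le> i" by linarith
    then show ?thesis
    proof cases
      case 1
      then have "L (Suc i) < L i" using dec[of i "Suc i"] by (simp add: L_def)
      then show ?thesis using 1 by (simp add: b_def)
    qed (auto simp: b_def)
  qed
  then have part: "is_partition lam" and bl: "beta lam = b"
    using partition_of_beta[of b N] unfolding lam_def by (simp_all add: b_def)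
  have zero: "lam i = 0" if "N \<le> i" for i using that by (simp add: lam_def b_def)
  have "shifted N lam i = L i" if "i < N" for i
    using shifted_beta[OF that, of lam] that by (simp add: bl b_def)
  then have sh: "shifted N lam i = ?l (r i)" if "i < N" for i using that by (simp add: L_def)
  then have shp: "shifted N lam (p j) = ?l j" if "j < N" for j using pN[OF that] by (simp add: rp)
  have match: "p \<in> matchings lam" using p shp by (simp add: matchings_def)
  have "mu i \<le> lam i" for i
  proof (cases "i < N")
    case True
    \<comment> \<open>Pigeonhole: the \<open>i + 1\<close> rows up to \<open>i\<close> cannot all be
      sent to rows before \<open>i\<close>. Such a \<open>j\<close> gives
      \<open>beta mu i <= beta mu j <= beta lam (p j) <= beta lam i\<close>.\<close>
    have "\<exists>j\<le>i. i \<le> p j"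
    proof (rule ccontr)
      assume "\<not> ?thesis"
      then have "p ` {..i} \<subseteq> {..<i}" by auto
      then have "card (p ` {..i}) \<le> card {..<i}" by (intro card_mono) auto
      moreover have "card (p ` {..i}) = card {..i}"
        by (rule card_image) (rule inj_on_subset[OF permutes_inj[OF p]], simp)
      ultimately show False by simp
    qed
    then obtain j where j: "j \<le> i" "i \<le> p j" by blast
    have jN: "j < N" using j True by simp
    have "beta mu i \<le> beta mu j" using j(1) beta_strict[OF mu, of j i] by (cases "j = i") auto
    moreover have "shifted N mu j \<le> shifted N lam (p j)" using shp[OF jN] by simp
    then have "beta mu j \<le> beta lam (p j)"
      using shifted_beta[OF jN, of mu] shifted_beta[OF pN[OF jN], of lam] by simp
    moreover have "beta lam (p j) \<le> beta lam i"
      using j(2) beta_strict[OF part, of i "p j"] by (cases "i = p j") auto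
    ultimately show ?thesis by (simp add: beta_def)
  qed (simp add: mu0)
  moreover have "part_size lam = part_size mu + n * k"
  proof -
    have "(\<Sum>i = 0..<N. shifted N lam i) = (\<Sum>i = 0..<N. ?l (r i))" using sh by simp
    also have "\<dots> = (\<Sum>i = 0..<N. ?l i)"
      using sum.permute[OF r, of ?l] by (simp add: o_def)
    also have "\<dots> = (\<Sum>i = 0..<N. shifted N mu i) + n * k"
      using e by (simp add: sum.distrib compositions_def flip: sum_distrib_left)
    finally show ?thesis by (simp add: sum_shifted[OF mu0] sum_shifted[OF zero])
  qed
  ultimately have "lam \<in> targets" using part zero by (simp add: targets_def le_fun_def)
  moreover have "steps (lam, p) = e"
  proof
    fix j
    show "steps (lam, p) j = e j"
    proof (cases "j < N")
      case True
      then have "n * steps (lam, p) j = n * e j" using steps_eq[OF match True] shp[OF True] by simp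
      then show ?thesis using n by simp
    next
      case False
      then show ?thesis using e by (simp add: steps_def compositions_def)
    qed
  qed
  ultimately show ?thesis using match by force
qed

text \<open>The Leibniz sum of the determinant is the sum of signs of the matchings, and each sign
  is absorbed by permuting the exponents of the alternant.\<close>

lemma strip_det_mult_alternant:
  "of_int (strip_det n N lam mu) * alternant N x (shifted N lam) =
     (\<Sum>p\<in>matchings lam. alternant N x (shifted N lam \<circ> p))"
proof -
  let ?E = "\<lambda>i j. strip_entry n lam mu i j :: int"
  have entry: "?E i j = (if shifted N mu j \<le> shifted N lam i \<and> n dvd shifted N lam i - shifted N mu j then 1 else 0)"
    if "i < N" "j < N" for i j
  proof -
    have "beta lam i - beta mu j = int (shifted N lam i) - int (shifted N mu j)"
      "beta mu j \<le> beta lam i \<longleftrightarrow> shifted N mu j \<le> shifted N lam i"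
      using shifted_beta[OF that(1), of lam] shifted_beta[OF that(2), of mu] by auto
    then show ?thesis
      by (auto simp: strip_entry_def of_nat_diff[symmetric] simp del: of_nat_diff)
  qed
  have prod: "(\<Prod>j = 0..<N. ?E (p j) j) = (if p \<in> matchings lam then 1 else 0)"
    if p: "p permutes {0..<N}" for p
  proof -
    have "p j < N" if "j < N" for j using permutes_in_image[OF p, of j] that by simp
    then have *: "?E (p j) j = (if shifted N mu j \<le> shifted N lam (p j) \<and>
        n dvd shifted N lam (p j) - shifted N mu j then 1 else 0)" if "j < N" for j
      using that by (intro entry) auto
    show ?thesis
    proof (cases "p \<in> matchings lam")
      case True
      then show ?thesis using * by (auto simp: matchings_def intro!: prod.neutral)
    next
      case False
      then obtain j where "j < N" "?E (p j) j = 0" using * p by (auto simp: matchings_def)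
      then have "(\<Prod>j = 0..<N. ?E (p j) j) = 0" by (intro prod_zero) auto
      then show ?thesis using False by simp
    qed
  qed
  have "strip_det n N lam mu = det (mat N N (\<lambda>(i, j). ?E j i))"
    unfolding strip_det_def by (rule det_mat_transpose[symmetric])
  also have "\<dots> = (\<Sum>p | p permutes {0..<N}. sign p * (if p \<in> matchings lam then 1 else 0))"
    unfolding det_mat_Leibniz by (intro sum.cong refl) (simp add: prod)
  also have "\<dots> = (\<Sum>p\<in>matchings lam. sign p)"
    by (intro sum.mono_neutral_cong_right finite_permutations) (auto simp: matchings_def)
  finally have "of_int (strip_det n N lam mu) * alternant N x (shifted N lam) =
      (\<Sum>p\<in>matchings lam. of_int (sign p) * alternant N x (shifted N lam))"
    by (simp add: sum_distrib_right)
  also have "\<dots> = (\<Sum>p\<in>matchings lam. alternant N x (shifted N lam \<circ> p))"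
    by (intro sum.cong refl) (simp add: alternant_permute matchings_def)
  finally show ?thesis .
qed

lemma finite_targets: "finite targets"
  by (rule finite_subset[OF _ finite_partitions_of[of "part_size mu + n * k" "\<lambda>lam. mu \<le> lam"]])
    (auto simp: targets_def)

lemma finite_matchings: "finite (matchings lam)"
  by (rule finite_subset[OF _ finite_permutations[of "{0..<N}"]]) (auto simp: matchings_def)

theorem plethysm_poly_mult_shifted_alternant:
  "plethysm_poly n k N x * alternant N x (shifted N mu) =
     (\<Sum>lam\<in>targets. of_int (strip_det n N lam mu) * alternant N x (shifted N lam))"
proof -
  let ?a = "\<lambda>e. alternant N x (\<lambda>j. shifted N mu j + n * e j)"
  let ?S = "SIGMA lam:targets. matchings lam"
  have "plethysm_poly n k N x * alternant N x (shifted N mu) = (\<Sum>e\<in>compositions N k. ?a e)"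
    by (rule plethysm_poly_mult_alternant)
  also have "\<dots> = (\<Sum>e\<in>steps ` ?S. ?a e)"
  proof (rule sum.mono_neutral_right[OF finite_compositions])
    show "steps ` ?S \<subseteq> compositions N k" using steps_in(1) by auto
    \<comment> \<open>By \<open>steps_surj\<close>, a composition outside the image leads to a
      repeated exponent.\<close>
    show "\<forall>e\<in>compositions N k - steps ` ?S. ?a e = 0"
      using steps_surj by (auto intro!: alternant_eq_0)
  qed
  also have "\<dots> = (\<Sum>s\<in>?S. ?a (steps s))" by (simp add: sum.reindex[OF inj_on_steps])
  also have "\<dots> = (\<Sum>(lam, p)\<in>?S. alternant N x (shifted N lam \<circ> p))"
    by (intro sum.cong refl) (auto intro!: alternant_cong simp: steps_eq)
  also have "\<dots> = (\<Sum>lam\<in>targets. \<Sum>p\<in>matchings lam. alternant N x (shifted N lam \<circ> p))"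
    by (rule sum.Sigma[symmetric]) (auto simp: finite_targets finite_matchings)
  finally show ?thesis by (simp add: strip_det_mult_alternant)
qed

end

subsection \<open>Comparison of coefficients\<close>

text \<open>Monomials are encoded as in \<open>symfun\<close>, so coefficients can be compared
  directly. The linear order on multisets makes the type an integral domain, as the alternant
  identities require.\<close>

type_synonym mpoly = "nat multiset \<Rightarrow>\<^sub>0 rat"

definition monom :: "nat multiset \<Rightarrow> mpoly" where
  "monom m = Poly_Mapping.single m 1"

definition var :: "nat \<Rightarrow> mpoly" where
  "var i = monom {#i#}"

lemma monom_empty: "monom {#} = 1"
  by (simp add: monom_def flip: single_one)

lemma monom_add: "monom (a + b) = monom a * monom b"
  by (simp add: monom_def Poly_Mapping.mult_single)

lemma monom_add_mset: "monom (add_mset i m) = var i * monom m"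
  using monom_add[of "{#i#}" m] by (simp add: var_def)

lemma lookup_monom: "poly_mapping.lookup (monom m) m' = (if m = m' then 1 else 0)"
  by (simp add: monom_def lookup_single when_def)

lemma prod_var: "finite D \<Longrightarrow> (\<Prod>b\<in>D. var (T b)) = monom (image_mset T (mset_set D))"
  by (induction rule: finite_induct) (simp_all add: monom_empty monom_add_mset)

lemma var_power: "var i ^ e = monom (replicate_mset e i)"
  by (induction e) (simp_all add: monom_empty monom_add_mset)

text \<open>This is the convolution formula that defines the product on
  \<open>symfun\<close>.\<close>

lemma lookup_mult_multiset:
  fixes f g :: mpoly
  shows "poly_mapping.lookup (f * g) m = (\<Sum>a | a \<subseteq># m. poly_mapping.lookup f a * poly_mapping.lookup g (m - a))"
proof -
  let ?r = "\<lambda>a. if a \<subseteq># m then poly_mapping.lookup g (m - a) else 0"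
  have inner: "(\<Sum>q. poly_mapping.lookup g q when m = a + q) = ?r a" for a
  proof -
    have "(\<Sum>q. poly_mapping.lookup g q when m = a + q) = (\<Sum>q\<in>{m - a}. poly_mapping.lookup g q when m = a + q)"
      by (rule Sum_any.expand_superset) (auto simp: when_def split: if_splits)
    moreover have "m = a + (m - a) \<longleftrightarrow> a \<subseteq># m"
      by (metis mset_subset_eq_add_left subset_mset.add_diff_inverse)
    ultimately show ?thesis by (simp add: when_def)
  qed
  have "poly_mapping.lookup (f * g) m = (\<Sum>a. poly_mapping.lookup f a * ?r a)"
    by (simp only: lookup_mult inner)
  also have "\<dots> = (\<Sum>a | a \<subseteq># m. poly_mapping.lookup f a * ?r a)"
    by (rule Sum_any.expand_superset[OF finite_submultisets]) (auto split: if_splits)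
  finally show ?thesis by simp
qed

text \<open>A tableau whose content is \<open>m\<close> has only entries in \<open>m\<close>, so the
  bound \<open>N\<close> on its entries holds automatically.\<close>

lemma lookup_schur_poly:
  assumes lam: "is_partition lam" and m: "set_mset m \<subseteq> {..<N}"
  shows "poly_mapping.lookup (schur_poly N var lam) m = scoeff (schur lam) m"
proof -
  have fin: "finite (diagram lam)" by (rule finite_diagram[OF lam])
  have "schur_poly N var lam = (\<Sum>T\<in>tableaux N lam. monom (tableau_content lam T))"
    unfolding schur_poly_def tableau_content_def by (intro sum.cong refl prod_var fin)
  then have "poly_mapping.lookup (schur_poly N var lam) m =
      (\<Sum>T\<in>tableaux N lam. if tableau_content lam T = m then 1 else 0)"
    by (simp add: lookup_sum lookup_monom)
  also have "\<dots> = of_nat (card {T \<in> tableaux N lam. tableau_content lam T = m})"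
    using finite_tableaux[OF lam] by (simp add: sum.If_cases Int_def)
  also have "{T \<in> tableaux N lam. tableau_content lam T = m} = {T. semistandard lam T \<and> tableau_content lam T = m}"
  proof -
    have "T b < N" if "tableau_content lam T = m" "b \<in> diagram lam" for T b
    proof -
      have "T b \<in># m" using that fin by (auto simp: tableau_content_def)
      then show ?thesis using m by auto
    qed
    then show ?thesis by (auto simp: tableaux_def)
  qed
  finally show ?thesis using lam by (simp add: schur.rep_eq kostka_def)
qed

lemma compositions_bij:
  "bij_betw (\<lambda>m. count m) {m. set_mset m \<subseteq> {0..<N} \<and> size m = k} (compositions N k)"
proof (rule bij_betwI')
  fix m m' :: "nat multiset"
  show "(count m = count m') = (m = m')" by (simp add: count_inject)
next
  fix m :: "nat multiset" assume m: "m \<in> {m. set_mset m \<subseteq> {0..<N} \<and> size m = k}"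
  then have "size m = (\<Sum>i = 0..<N. count m i)"
    unfolding size_multiset_overloaded_eq by (intro sum.mono_neutral_left) (auto simp: not_in_iff)
  moreover have "count m i = 0" if "N \<le> i" for i using m that by (auto simp: not_in_iff[symmetric])
  ultimately show "count m \<in> compositions N k" using m by (simp add: compositions_def)
next
  fix e assume e: "e \<in> compositions N k"
  have "i < N" if "0 < e i" for i
    using e that by (cases "i < N") (auto simp: compositions_def)
  then have supp: "{i. 0 < e i} \<subseteq> {0..<N}" by auto
  have "finite {i. 0 < e i}" by (rule finite_subset[OF supp]) simp
  then have c: "count (Abs_multiset e) = e" by simp
  then have sub: "set_mset (Abs_multiset e) \<subseteq> {0..<N}"
    using supp by (simp add: set_mset_def)
  have "size (Abs_multiset e) = (\<Sum>i = 0..<N. e i)"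
    unfolding size_multiset_overloaded_eq c
    by (intro sum.mono_neutral_left sub) (auto simp: set_mset_def c)
  then show "\<exists>m\<in>{m. set_mset m \<subseteq> {0..<N} \<and> size m = k}. e = count m"
    using c sub e by (intro bexI[of _ "Abs_multiset e"]) (auto simp: compositions_def)
qed

lemma prod_var_power:
  assumes "set_mset m \<subseteq> {0..<N}"
  shows "(\<Prod>i = 0..<N. var i ^ (n * count m i)) = monom (repeat_mset n m)"
proof -
  have "(\<Prod>i\<in>A. monom (f i)) = monom (\<Sum>i\<in>A. f i)" for A :: "nat set" and f
    by (induction A rule: infinite_finite_induct) (simp_all add: monom_empty monom_add)
  then have "(\<Prod>i = 0..<N. var i ^ (n * count m i)) = monom (\<Sum>i = 0..<N. replicate_mset (n * count m i) i)"
    by (simp add: var_power)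
  also have "(\<Sum>i = 0..<N. replicate_mset (n * count m i) i) = repeat_mset n m"
  proof (rule multiset_eqI)
    fix v
    have "count (\<Sum>i = 0..<N. replicate_mset (n * count m i) i) v = (\<Sum>i = 0..<N. if i = v then n * count m i else 0)"
      by (simp add: count_sum)
    also have "\<dots> = (if v < N then n * count m v else 0)" by simp
    also have "\<dots> = count (repeat_mset n m) v"
      using assms by (cases "v \<in># m") (auto simp: not_in_iff)
    finally show "count (\<Sum>i = 0..<N. replicate_mset (n * count m i) i) v = \<dots>" .
  qed
  finally show ?thesis .
qed

lemma lookup_plethysm_poly:
  assumes n: "n > 0" and m: "set_mset m \<subseteq> {..<N}"
  shows "poly_mapping.lookup (plethysm_poly n k N var) m = scoeff (power_sum_plethysm n (complete_sym k)) m"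
proof -
  let ?M = "{m'. set_mset m' \<subseteq> {0..<N} \<and> size m' = k}"
  have finM: "finite ?M" using compositions_bij finite_compositions by (rule bij_betw_finite[THEN iffD2])
  have fin: "finite {m'. repeat_mset n m' = m}"
  proof (rule finite_subset)
    show "{m'. repeat_mset n m' = m} \<subseteq> {a. a \<subseteq># m}"
      using n by (auto simp: subseteq_mset_def)
  qed (rule finite_submultisets)
  have "plethysm_poly n k N var = (\<Sum>m'\<in>?M. monom (repeat_mset n m'))"
    unfolding plethysm_poly_def sum.reindex_bij_betw[OF compositions_bij, symmetric]
    by (intro sum.cong refl prod_var_power) simp
  then have "poly_mapping.lookup (plethysm_poly n k N var) m = (\<Sum>m'\<in>?M. if repeat_mset n m' = m then 1 else 0)"
    by (simp add: lookup_sum lookup_monom)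
  also have "\<dots> = of_nat (card (?M \<inter> {m'. repeat_mset n m' = m}))"
    using finM by (simp add: sum.If_cases)
  also have "?M \<inter> {m'. repeat_mset n m' = m} = {m'. repeat_mset n m' = m} \<inter> {m'. size m' = k}"
  proof -
    have "set_mset m' \<subseteq> {0..<N}" if "repeat_mset n m' = m" for m'
    proof -
      \<comment> \<open>With \<open>n > 0\<close>, repetition preserves the set of
        variables.\<close>
      have "set_mset m' \<subseteq> set_mset m" unfolding that[symmetric] using n by (auto simp flip: count_greater_zero_iff)
      then show ?thesis using m by auto
    qed
    then show ?thesis by auto
  qed
  also have "of_nat (card \<dots>) = (\<Sum>m' | repeat_mset n m' = m. if size m' = k then 1 else 0 :: rat)"
    using fin by (simp add: sum.If_cases)
  finally show ?thesis by (simp add: power_sum_plethysm.rep_eq complete_sym.rep_eq)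
qed

text \<open>Meant for extraction of a coefficient, which is additive but not multiplicative.\<close>

lemma additive_of_int_mult:
  fixes \<phi> :: "'a::ring_1 \<Rightarrow> 'b::ring_1"
  assumes add: "\<And>x y. \<phi> (x + y) = \<phi> x + \<phi> y"
  shows "\<phi> (of_int d * x) = of_int d * \<phi> x"
proof -
  have zero: "\<phi> 0 = 0" using add[of 0 0] by simp
  have neg: "\<phi> (- y) = - \<phi> y" for y using add[of y "- y"] by (simp add: zero eq_neg_iff_add_eq_0 add.commute)
  have nat: "\<phi> (of_nat i * x) = of_nat i * \<phi> x" for i
    by (induction i) (simp_all add: zero add algebra_simps)
  show ?thesis by (cases d rule: int_cases2) (simp_all add: nat neg)
qed

section \<open>Transfer to symmetric functions\<close>

lemma scoeff_add: "scoeff (f + g) m = scoeff f m + scoeff g m"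
  by (simp add: plus_symfun.rep_eq)

lemma scoeff_sum: "scoeff (\<Sum>i\<in>A. f i) m = (\<Sum>i\<in>A. scoeff (f i) m)"
  by (induction A rule: infinite_finite_induct) (simp_all add: scoeff_add zero_symfun.rep_eq)

lemma staircase_alternant_nonzero: "alternant N var (shifted N (\<lambda>_. 0)) \<noteq> 0"
proof (induction N)
  case (Suc N)
  have "var j \<noteq> var N" if "j < N" for j
  proof
    assume "var j = var N"
    then have "poly_mapping.lookup (var j) {#j#} = poly_mapping.lookup (var N) {#j#}" by simp
    then show False using that by (simp add: var_def lookup_monom)
  qed
  then show ?case using Suc by (auto simp: alternant_staircase_Suc)
qed (simp add: alternant_def)

text \<open>Multiplication by the staircase alternant turns the Schur polynomials into alternants;
  as it is nonzero, it can be cancelled afterwards.\<close>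

lemma plethysm_poly_mult_schur_poly:
  assumes n: "n > 0" and mu: "is_partition mu" and N: "\<And>i. N \<le> i \<Longrightarrow> mu i = 0"
  shows "plethysm_poly n k N var * schur_poly N var mu =
    (\<Sum>lam\<in>targets n k N mu. of_int (strip_det n N lam mu) * schur_poly N var lam)"
proof -
  let ?d = "alternant N var (shifted N (\<lambda>_. 0))"
  have "?d * (plethysm_poly n k N var * schur_poly N var mu) =
      plethysm_poly n k N var * alternant N var (shifted N mu)"
    by (simp add: alternant_schur_poly[OF mu N[OF order_refl]] mult_ac)
  also have "\<dots> = (\<Sum>lam\<in>targets n k N mu. of_int (strip_det n N lam mu) * alternant N var (shifted N lam))"
    by (rule plethysm_poly_mult_shifted_alternant[OF n mu N])
  also have "\<dots> = (\<Sum>lam\<in>targets n k N mu. ?d * (of_int (strip_det n N lam mu) * schur_poly N var lam))"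
    by (intro sum.cong refl) (simp add: targets_def[OF n mu N] alternant_schur_poly mult_ac)
  finally show ?thesis
    using staircase_alternant_nonzero[of N] by (simp flip: sum_distrib_left)
qed

lemma partition_zero_beyond_size:
  assumes lam: "is_partition lam" and i: "part_size lam \<le> i"
  shows "lam i = 0"
proof (rule ccontr)
  assume "lam i \<noteq> 0"
  then have pos: "0 < lam j" if "j \<le> i" for j using is_partitionD[OF lam that] by simp
  obtain M where M: "\<And>j. M \<le> j \<Longrightarrow> lam j = 0" using partition_eventually_zero[OF lam] by blast
  then have "i < M" using \<open>lam i \<noteq> 0\<close> by (meson not_le)
  have "Suc i = (\<Sum>j = 0..<Suc i. 1)" by simp
  also have "\<dots> \<le> (\<Sum>j = 0..<Suc i. lam j)" using pos by (intro sum_mono) (simp add: Suc_leI)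
  also have "\<dots> \<le> (\<Sum>j = 0..<M. lam j)" using \<open>i < M\<close> by (intro sum_mono2) auto
  also have "\<dots> = part_size lam" by (rule part_size_eq[symmetric]) (rule M)
  finally show False using i by simp
qed

text \<open>Coefficients are compared one monomial at a time, so the number of variables may depend
  on the monomial.\<close>

theorem plethysm_mult_schur:
  assumes n: "n > 0" and mu: "is_partition mu"
  shows "power_sum_plethysm n (complete_sym k) * schur mu =
      (\<Sum>lam | is_partition lam \<and> part_size lam = part_size mu + n * k \<and> mu \<le> lam.
         of_int (det (strip_matrix n lam mu)) * schur lam)"
proof (rule symfun_eqI)
  fix m :: "nat multiset"
  let ?P = "{lam. is_partition lam \<and> part_size lam = part_size mu + n * k \<and> mu \<le> lam}"
  obtain b where b: "\<And>i. i \<in># m \<Longrightarrow> i < b"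
    using finite_nat_set_iff_bounded[of "set_mset m"] by auto
  \<comment> \<open>Large enough for all variables in \<open>m\<close> and for all rows of every
    \<open>lam\<close> in the sum, so that \<open>targets\<close> is the whole index set.\<close>
  define N where "N = max b (part_size mu + n * k)"
  have m: "set_mset m \<subseteq> {..<N}" using b by (auto simp: N_def less_max_iff_disj)
  have N: "mu i = 0" if "N \<le> i" for i
    using partition_zero_beyond_size[OF mu, of i] that by (simp add: N_def)
  have zero: "lam i = 0" if "lam \<in> ?P" "N \<le> i" for lam i
    using partition_zero_beyond_size[of lam i] that by (simp add: N_def)
  have targets: "targets n k N mu = ?P"
    using zero by (auto simp: targets_def[OF n mu N])
  have sub: "set_mset a \<subseteq> {..<N}" if "a \<subseteq># m" for a
    using set_mset_mono[OF that] m by blast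
  have strip: "strip_det n N lam mu = det (strip_matrix n lam mu)" if lam: "lam \<in> ?P" for lam
  proof (rule det_strip_matrix[symmetric])
    show "num_parts lam \<le> N"
      using num_parts_iff[of lam N] zero[OF lam, of N] lam by simp
  qed (use lam in auto)
  have "scoeff (power_sum_plethysm n (complete_sym k) * schur mu) m =
      (\<Sum>a | a \<subseteq># m. scoeff (power_sum_plethysm n (complete_sym k)) a * scoeff (schur mu) (m - a))"
    by (rule times_symfun.rep_eq[THEN fun_cong])
  also have "\<dots> = (\<Sum>a | a \<subseteq># m. poly_mapping.lookup (plethysm_poly n k N var) a *
      poly_mapping.lookup (schur_poly N var mu) (m - a))"
    by (intro sum.cong refl) (simp add: lookup_plethysm_poly[OF n] lookup_schur_poly[OF mu] sub)
  also have "\<dots> = poly_mapping.lookup (plethysm_poly n k N var * schur_poly N var mu) m"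
    by (rule lookup_mult_multiset[symmetric])
  also have "plethysm_poly n k N var * schur_poly N var mu =
      (\<Sum>lam\<in>targets n k N mu. of_int (strip_det n N lam mu) * schur_poly N var lam)"
    by (rule plethysm_poly_mult_schur_poly[OF n mu]) (rule N)
  also have "poly_mapping.lookup \<dots> m =
      (\<Sum>lam\<in>?P. of_int (strip_det n N lam mu) * poly_mapping.lookup (schur_poly N var lam) m)"
    unfolding targets lookup_sum
    by (intro sum.cong refl additive_of_int_mult[where \<phi> = "\<lambda>f. poly_mapping.lookup f m"] lookup_add)
  also have "\<dots> = (\<Sum>lam\<in>?P. of_int (det (strip_matrix n lam mu)) * scoeff (schur lam) m)"
    by (intro sum.cong refl) (simp add: strip lookup_schur_poly m)
  also have "\<dots> = scoeff (\<Sum>lam\<in>?P. of_int (det (strip_matrix n lam mu)) * schur lam) m"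
    unfolding scoeff_sum
    by (intro sum.cong refl additive_of_int_mult[where \<phi> = "\<lambda>f. scoeff f m", symmetric] scoeff_add)
  finally show "scoeff (power_sum_plethysm n (complete_sym k) * schur mu) m =
    scoeff (\<Sum>lam\<in>?P. of_int (det (strip_matrix n lam mu)) * schur lam) m" .
qed

theorem corollary3p11:
  fixes n k :: nat and mu :: "nat \<Rightarrow> nat"
  assumes "n > 0" and "k > 0" and "is_partition mu"
  shows "power_sum_plethysm n (complete_sym k) * schur mu =
      (\<Sum>lam | is_partition lam \<and> part_size lam = part_size mu + n * k \<and> mu \<le> lam.
         of_int (det (strip_matrix n lam mu)) * schur lam) \<and>
    (\<forall>lam. is_partition lam \<longrightarrow> part_size lam = part_size mu + n * k \<longrightarrow> mu \<le> lam \<longrightarrow>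
       det (strip_matrix n lam mu) =
         (if horizontal_border_strip n k lam mu then strip_sign n k lam mu else 0))"
  using plethysm_mult_schur[OF assms(1,3)] det_strip_matrix_eq_sign[OF assms(1) _ assms(3)] by simp

end
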